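(* Every von Neumann regular commutative ring is CFQ.
   Context: A commutative ring $R$ is von Neumann regular if for every $a \in R$ there is $b\in R$ with $aba=a$. For a commutative ring $R$, an $R$-module $C$ is almost cotorsion if $\mathrm{Ext}^1_R(S^{-1}R, C) = 0$ for every (at most) countable multiplicative subset $S \subseteq R$; an $R$-module $F$ is quite flat if $\mathrm{Ext}^1_R(F, C) = 0$ for every almost cotorsion $R$-module $C$. A commutative ring $R$ is called CFQ if every countably presented flat $R$-module is quite flat. *)

theory Defs
  imports "HOL-Algebra.Module" "HOL-Algebra.Ideal" "HOL-Library.Countable_Set"
begin

definition von_neumann_regular :: "'a ring \<Rightarrow> bool" where
  "von_neumann_regular R \<longleftrightarrow>
     (\<forall>a\<in>carrier R. \<exists>b\<in>carrier R. a \<otimes>\<^bsub>R\<^esub> b \<otimes>\<^bsub>R\<^esub> a = a)"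

definition mod_hom :: "'a ring \<Rightarrow> ('a,'b) module \<Rightarrow> ('a,'c) module \<Rightarrow> ('b \<Rightarrow> 'c) \<Rightarrow> bool" where
  "mod_hom R M N f \<longleftrightarrow>
     f \<in> carrier M \<rightarrow> carrier N \<and>
     (\<forall>x\<in>carrier M. \<forall>y\<in>carrier M. f (x \<oplus>\<^bsub>M\<^esub> y) = f x \<oplus>\<^bsub>N\<^esub> f y) \<and>
     (\<forall>r\<in>carrier R. \<forall>x\<in>carrier M. f (r \<odot>\<^bsub>M\<^esub> x) = r \<odot>\<^bsub>N\<^esub> f x)"

text \<open>Ext^1_R(A,C) = 0 iff every short exact sequence 0 -> C -> B -> A -> 0 of
  R-modules splits. Every such extension is isomorphic to one whose underlying
  set is a subset of C x A, so it suffices to let B range over modules whose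
  elements have type 'c \<times> 'x.\<close>
definition ext1_vanishes :: "'a ring \<Rightarrow> ('a,'x) module \<Rightarrow> ('a,'c) module \<Rightarrow> bool" where
  "ext1_vanishes R A C \<longleftrightarrow>
     (\<forall>(B :: ('a, 'c \<times> 'x) module) f g.
        module R B \<and> mod_hom R C B f \<and> mod_hom R B A g \<and>
        inj_on f (carrier C) \<and> g ` carrier B = carrier A \<and>
        f ` carrier C = {b \<in> carrier B. g b = \<zero>\<^bsub>A\<^esub>}
        \<longrightarrow> (\<exists>s. mod_hom R A B s \<and> (\<forall>x\<in>carrier A. g (s x) = x)))"

definition mult_subset :: "'a ring \<Rightarrow> 'a set \<Rightarrow> bool" where
  "mult_subset R S \<longleftrightarrow> S \<subseteq> carrier R \<and> \<one>\<^bsub>R\<^esub> \<in> S \<and>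
     (\<forall>s\<in>S. \<forall>t\<in>S. s \<otimes>\<^bsub>R\<^esub> t \<in> S)"

definition loc_rel :: "'a ring \<Rightarrow> 'a set \<Rightarrow> (('a \<times> 'a) \<times> ('a \<times> 'a)) set" where
  "loc_rel R S = {((r, s), (r', s')). r \<in> carrier R \<and> s \<in> S \<and> r' \<in> carrier R \<and> s' \<in> S \<and>
      (\<exists>t\<in>S. t \<otimes>\<^bsub>R\<^esub> (r \<otimes>\<^bsub>R\<^esub> s' \<ominus>\<^bsub>R\<^esub> r' \<otimes>\<^bsub>R\<^esub> s) = \<zero>\<^bsub>R\<^esub>)}"

definition rep :: "'b set \<Rightarrow> 'b" where
  "rep X = (SOME p. p \<in> X)"

text \<open>Fractions r/s are equivalence classes of pairs (r,s); operations are
  computed on chosen representatives (they are well defined).\<close>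
definition loc_module :: "'a ring \<Rightarrow> 'a set \<Rightarrow> ('a, ('a \<times> 'a) set) module" where
  "loc_module R S =
     \<lparr>carrier = (carrier R \<times> S) // loc_rel R S,
      mult = (\<lambda>X Y. loc_rel R S `` {(fst (rep X) \<otimes>\<^bsub>R\<^esub> fst (rep Y), snd (rep X) \<otimes>\<^bsub>R\<^esub> snd (rep Y))}),
      one = loc_rel R S `` {(\<one>\<^bsub>R\<^esub>, \<one>\<^bsub>R\<^esub>)},
      zero = loc_rel R S `` {(\<zero>\<^bsub>R\<^esub>, \<one>\<^bsub>R\<^esub>)},
      add = (\<lambda>X Y. loc_rel R S ``
               {(fst (rep X) \<otimes>\<^bsub>R\<^esub> snd (rep Y) \<oplus>\<^bsub>R\<^esub> fst (rep Y) \<otimes>\<^bsub>R\<^esub> snd (rep X),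
                 snd (rep X) \<otimes>\<^bsub>R\<^esub> snd (rep Y))}),
      smult = (\<lambda>a X. loc_rel R S `` {(a \<otimes>\<^bsub>R\<^esub> fst (rep X), snd (rep X))})\<rparr>"

definition almost_cotorsion :: "'a ring \<Rightarrow> ('a,'c) module \<Rightarrow> bool" where
  "almost_cotorsion R C \<longleftrightarrow>
     (\<forall>S. mult_subset R S \<and> countable S \<longrightarrow> ext1_vanishes R (loc_module R S) C)"

text \<open>F is quite flat: Ext^1(F,C) = 0 for all almost cotorsion C. The type
  argument fixes the element type of the test modules C; a theorem with a free
  type variable there quantifies over all of them.\<close>
definition quite_flat :: "'a ring \<Rightarrow> ('a,'f) module \<Rightarrow> 'c itself \<Rightarrow> bool" where
  "quite_flat R F (_ :: 'c itself) \<longleftrightarrow>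
     (\<forall>C :: ('a,'c) module. module R C \<and> almost_cotorsion R C \<longrightarrow> ext1_vanishes R F C)"

definition free_nat_module :: "'a ring \<Rightarrow> ('a, nat \<Rightarrow> 'a) module" where
  "free_nat_module R =
     \<lparr>carrier = {u. (\<forall>n. u n \<in> carrier R) \<and> finite {n. u n \<noteq> \<zero>\<^bsub>R\<^esub>}},
      mult = (\<lambda>u v n. \<zero>\<^bsub>R\<^esub>),
      one = (\<lambda>n. \<zero>\<^bsub>R\<^esub>),
      zero = (\<lambda>n. \<zero>\<^bsub>R\<^esub>),
      add = (\<lambda>u v n. u n \<oplus>\<^bsub>R\<^esub> v n),
      smult = (\<lambda>r u n. r \<otimes>\<^bsub>R\<^esub> u n)\<rparr>"

definition submodule_gen :: "'a ring \<Rightarrow> ('a,'b) module \<Rightarrow> 'b set \<Rightarrow> 'b set" where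
  "submodule_gen R M K = \<Inter> {N. submodule N R M \<and> K \<subseteq> N}"

definition countably_presented :: "'a ring \<Rightarrow> ('a,'f) module \<Rightarrow> bool" where
  "countably_presented R F \<longleftrightarrow>
     (\<exists>\<pi>. mod_hom R (free_nat_module R) F \<pi> \<and>
          \<pi> ` carrier (free_nat_module R) = carrier F \<and>
          (\<exists>K. countable K \<and> K \<subseteq> carrier (free_nat_module R) \<and>
               {u \<in> carrier (free_nat_module R). \<pi> u = \<zero>\<^bsub>F\<^esub>} = submodule_gen R (free_nat_module R) K))"

text \<open>The tensor product I \<otimes>_R F is the free abelian group on I \<times> F (finitely
  supported int-valued functions) modulo the subgroup generated by the
  bilinearity/balancing relations.\<close>
definition delta :: "'b \<Rightarrow> 'b \<Rightarrow> int" where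
  "delta p = (\<lambda>q. if q = p then 1 else 0)"

inductive_set int_span :: "('b \<Rightarrow> int) set \<Rightarrow> ('b \<Rightarrow> int) set" for G where
  zero: "(\<lambda>_. 0) \<in> int_span G"
| gen: "g \<in> G \<Longrightarrow> g \<in> int_span G"
| add: "u \<in> int_span G \<Longrightarrow> v \<in> int_span G \<Longrightarrow> (\<lambda>q. u q + v q) \<in> int_span G"
| neg: "u \<in> int_span G \<Longrightarrow> (\<lambda>q. - u q) \<in> int_span G"

definition tensor_relations :: "'a ring \<Rightarrow> 'a set \<Rightarrow> ('a,'f) module \<Rightarrow> ('a \<times> 'f \<Rightarrow> int) set" where
  "tensor_relations R I F =
     {(\<lambda>q. delta (i \<oplus>\<^bsub>R\<^esub> i', x) q - delta (i, x) q - delta (i', x) q) | i i' x.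
        i \<in> I \<and> i' \<in> I \<and> x \<in> carrier F} \<union>
     {(\<lambda>q. delta (i, x \<oplus>\<^bsub>F\<^esub> x') q - delta (i, x) q - delta (i, x') q) | i x x'.
        i \<in> I \<and> x \<in> carrier F \<and> x' \<in> carrier F} \<union>
     {(\<lambda>q. delta (r \<otimes>\<^bsub>R\<^esub> i, x) q - delta (i, r \<odot>\<^bsub>F\<^esub> x) q) | r i x.
        r \<in> carrier R \<and> i \<in> I \<and> x \<in> carrier F}"

text \<open>The map I \<otimes>_R F -> R \<otimes>_R F = F, i \<otimes> x \<mapsto> i x, on formal sums.\<close>
definition tensor_mult_map :: "('a,'f) module \<Rightarrow> ('a \<times> 'f \<Rightarrow> int) \<Rightarrow> 'f" where
  "tensor_mult_map F u =
     (\<Oplus>\<^bsub>F\<^esub> p \<in> {p. u p \<noteq> 0}. add_pow F (u p) (fst p \<odot>\<^bsub>F\<^esub> snd p))"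

text \<open>F is flat iff I \<otimes>_R F -> R \<otimes>_R F is injective for every ideal I of R.\<close>
definition flat :: "'a ring \<Rightarrow> ('a,'f) module \<Rightarrow> bool" where
  "flat R F \<longleftrightarrow>
     (\<forall>I. ideal I R \<longrightarrow>
        (\<forall>u. finite {p. u p \<noteq> 0} \<and> {p. u p \<noteq> 0} \<subseteq> I \<times> carrier F \<and>
             tensor_mult_map F u = \<zero>\<^bsub>F\<^esub>
             \<longrightarrow> u \<in> int_span (tensor_relations R I F)))"

text \<open>R is CFQ: every countably presented flat R-module is quite flat. The type
  arguments fix element types of F and of the test modules C; with free type
  variables the statement covers all modules.\<close>
definition CFQ :: "'a ring \<Rightarrow> 'f itself \<Rightarrow> 'c itself \<Rightarrow> bool" where
  "CFQ R (_ :: 'f itself) (_ :: 'c itself) \<longleftrightarrow>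
     (\<forall>F :: ('a,'f) module. module R F \<and> countably_presented R F \<and> flat R F
        \<longrightarrow> quite_flat R F TYPE('c))"

end

theory Submission
  imports Defs
begin

text \<open>
  Write $F = R^{(\mathbb{N})}/K$ with $K$ countably generated, and filter $F$ by the images $F_n$ of
  $R^n$. The quotient $F_{n+1}/F_n$ is $R/I_n$, where $I_n$ consists of the $n$-th coordinates of
  the elements of $K \cap R^{n+1}$. Over a von Neumann regular ring the intersection of a finitely
  generated submodule of $R^{(\mathbb{N})}$ with $R^{n+1}$ is again finitely generated, so $I_n$ is the
  union of a chain $e_0 R \subseteq e_1 R \subseteq \dots$ with idempotent $e_j$. Hence
  $R/I_n \cong S^{-1}R$ for the countable multiplicative set $S = \{1 - e_j\}$, and an almost
  cotorsion $C$ satisfies $\mathrm{Ext}^1(R/I_n, C) = 0$ for all $n$. A section of an extension of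
  $F$ by $C$ can therefore be built along the filtration, one generator at a time.
\<close>

text \<open>The intersection claim holds because over such a ring the kernel of a linear form on a
  finitely generated module splits off: the values of the form make up an ideal generated by an
  idempotent, and a preimage of that idempotent gives a projection onto the kernel. Coordinates can
  then be killed one at a time. A chain of idempotents is needed because K itself need not be
  finitely generated; each e_j comes from a finitely generated piece of an exhaustion of K.
  Vanishing of Ext^1(R/I, C) is used in the form that every linear map I \<rightarrow> C is
  multiplication by an element of C. Deriving this needs a pushout, and \<open>ext1_vanishes\<close>
  prescribes the element type of the extension, so that the pushout cannot be built from cosets. The
  induction on n never revises a lift: a relation supported on {0,...,n} is unaffected by the lifts
  chosen later, and every relation has finite support.\<close>

section \<open>Linear maps, and the ring as a module over itself\<close>

lemma mod_homD:
  assumes "mod_hom R M N f"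
  shows "x \<in> carrier M \<Longrightarrow> f x \<in> carrier N"
    and "x \<in> carrier M \<Longrightarrow> y \<in> carrier M \<Longrightarrow> f (x \<oplus>\<^bsub>M\<^esub> y) = f x \<oplus>\<^bsub>N\<^esub> f y"
    and "r \<in> carrier R \<Longrightarrow> x \<in> carrier M \<Longrightarrow> f (r \<odot>\<^bsub>M\<^esub> x) = r \<odot>\<^bsub>N\<^esub> f x"
  using assms by (auto simp: mod_hom_def)

lemma mod_homI:
  assumes "\<And>x. x \<in> carrier M \<Longrightarrow> f x \<in> carrier N"
    and "\<And>x y. x \<in> carrier M \<Longrightarrow> y \<in> carrier M \<Longrightarrow> f (x \<oplus>\<^bsub>M\<^esub> y) = f x \<oplus>\<^bsub>N\<^esub> f y"
    and "\<And>r x. r \<in> carrier R \<Longrightarrow> x \<in> carrier M \<Longrightarrow> f (r \<odot>\<^bsub>M\<^esub> x) = r \<odot>\<^bsub>N\<^esub> f x"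
  shows "mod_hom R M N f"
  using assms by (auto simp: mod_hom_def)

lemma mod_hom_zero:
  assumes "module R M" "module R N" "mod_hom R M N f"
  shows "f \<zero>\<^bsub>M\<^esub> = \<zero>\<^bsub>N\<^esub>"
proof -
  interpret M: module R M by fact
  interpret N: module R N by fact
  have "f (\<zero>\<^bsub>R\<^esub> \<odot>\<^bsub>M\<^esub> \<zero>\<^bsub>M\<^esub>) = \<zero>\<^bsub>R\<^esub> \<odot>\<^bsub>N\<^esub> f \<zero>\<^bsub>M\<^esub>"
    by (rule mod_homD(3)[OF assms(3)]) auto
  then show ?thesis using mod_homD(1)[OF assms(3)] by simp
qed

lemma mod_hom_minus:
  assumes "module R M" "module R N" "mod_hom R M N f" "x \<in> carrier M"
  shows "f (\<ominus>\<^bsub>M\<^esub> x) = \<ominus>\<^bsub>N\<^esub> f x"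
proof -
  interpret M: module R M by fact
  interpret N: module R N by fact
  have "f (\<ominus>\<^bsub>M\<^esub> x) = f ((\<ominus>\<^bsub>R\<^esub> \<one>\<^bsub>R\<^esub>) \<odot>\<^bsub>M\<^esub> x)"
    using assms(4) by (simp add: M.smult_l_minus)
  also have "\<dots> = (\<ominus>\<^bsub>R\<^esub> \<one>\<^bsub>R\<^esub>) \<odot>\<^bsub>N\<^esub> f x"
    using assms(4) by (intro mod_homD(3)[OF assms(3)]) auto
  finally show ?thesis
    using mod_homD(1)[OF assms(3,4)] by (simp add: N.smult_l_minus)
qed

text \<open>Linear forms on M become instances of \<open>mod_hom\<close>, and R can serve as a
  summand in a product of modules.\<close>

definition regular_module :: "'a ring \<Rightarrow> ('a, 'a) module" where
  "regular_module R = \<lparr>carrier = carrier R, mult = mult R, one = \<one>\<^bsub>R\<^esub>, zero = \<zero>\<^bsub>R\<^esub>,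
     add = add R, smult = mult R\<rparr>"

lemma regular_module_simps [simp]:
  "carrier (regular_module R) = carrier R"
  "zero (regular_module R) = \<zero>\<^bsub>R\<^esub>"
  "add (regular_module R) = add R"
  "smult (regular_module R) = mult R"
  by (simp_all add: regular_module_def)

lemma module_regular_module:
  assumes "cring R"
  shows "module R (regular_module R)"
proof -
  interpret cring R by fact
  show ?thesis
  proof (rule moduleI[OF assms abelian_groupI])
    fix x assume "x \<in> carrier (regular_module R)"
    then show "\<exists>y\<in>carrier (regular_module R). y \<oplus>\<^bsub>regular_module R\<^esub> x = \<zero>\<^bsub>regular_module R\<^esub>"
      by (intro bexI[of _ "\<ominus>\<^bsub>R\<^esub> x"]) (auto simp: l_neg)
  qed (auto simp: a_ac m_ac l_distr r_distr)
qed

section \<open>Finitely generated submodules over a von Neumann regular ring\<close>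

text \<open>Generators are adjoined one at a time, so inductions pass from P to P + Rk and finite
  linear combinations never have to be handled.\<close>

inductive fin_gen :: "('a,'m) ring_scheme \<Rightarrow> ('a,'b,'k) module_scheme \<Rightarrow> 'b set \<Rightarrow> bool" for R M where
  zero: "fin_gen R M {\<zero>\<^bsub>M\<^esub>}"
| extend: "fin_gen R M P \<Longrightarrow> k \<in> carrier M \<Longrightarrow>
    fin_gen R M {p \<oplus>\<^bsub>M\<^esub> r \<odot>\<^bsub>M\<^esub> k | p r. p \<in> P \<and> r \<in> carrier R}"

lemma (in module) submodule_zero_closed: "submodule P R M \<Longrightarrow> \<zero>\<^bsub>M\<^esub> \<in> P"
  using subgroup.one_closed[OF submodule.axioms(1)] by simp

lemma (in module) submodule_extend:
  assumes "submodule P R M" "k \<in> carrier M"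
  shows "submodule {p \<oplus>\<^bsub>M\<^esub> r \<odot>\<^bsub>M\<^esub> k | p r. p \<in> P \<and> r \<in> carrier R} R M" (is "submodule ?Q R M")
proof -
  note P = submoduleE[OF assms(1)]
  have PM: "p \<in> carrier M" if "p \<in> P" for p using that P(1) by auto
  have zP: "\<zero>\<^bsub>M\<^esub> \<in> P" by (rule submodule_zero_closed[OF assms(1)])
  show ?thesis
  proof (rule submoduleI)
    show "?Q \<subseteq> carrier M" using PM assms(2) by auto
    show "\<zero>\<^bsub>M\<^esub> \<in> ?Q"
      using zP assms(2) by (auto intro!: exI[of _ "\<zero>\<^bsub>M\<^esub>"] exI[of _ "\<zero>\<^bsub>R\<^esub>"])
  next
    fix a assume "a \<in> ?Q"
    then obtain p r where a: "a = p \<oplus>\<^bsub>M\<^esub> r \<odot>\<^bsub>M\<^esub> k" "p \<in> P" "r \<in> carrier R" by auto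
    have "\<ominus>\<^bsub>M\<^esub> a = \<ominus>\<^bsub>M\<^esub> p \<oplus>\<^bsub>M\<^esub> (\<ominus>\<^bsub>R\<^esub> r) \<odot>\<^bsub>M\<^esub> k"
      using a PM assms(2) by (simp add: M.minus_add smult_l_minus M.a_comm)
    then show "\<ominus>\<^bsub>M\<^esub> a \<in> ?Q" using a P(3) by auto
  next
    fix a b assume "a \<in> ?Q" "b \<in> ?Q"
    then obtain p r p' r' where a: "a = p \<oplus>\<^bsub>M\<^esub> r \<odot>\<^bsub>M\<^esub> k" "p \<in> P" "r \<in> carrier R"
      and b: "b = p' \<oplus>\<^bsub>M\<^esub> r' \<odot>\<^bsub>M\<^esub> k" "p' \<in> P" "r' \<in> carrier R" by auto
    have "a \<oplus>\<^bsub>M\<^esub> b = (p \<oplus>\<^bsub>M\<^esub> p') \<oplus>\<^bsub>M\<^esub> (r \<oplus>\<^bsub>R\<^esub> r') \<odot>\<^bsub>M\<^esub> k"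
      using a b PM assms(2) by (simp add: smult_l_distr M.a_ac)
    then show "a \<oplus>\<^bsub>M\<^esub> b \<in> ?Q" using a b P(5) by blast
  next
    fix a x assume ax: "a \<in> carrier R" "x \<in> ?Q"
    then obtain p r where x: "x = p \<oplus>\<^bsub>M\<^esub> r \<odot>\<^bsub>M\<^esub> k" "p \<in> P" "r \<in> carrier R" by auto
    have "a \<odot>\<^bsub>M\<^esub> x = a \<odot>\<^bsub>M\<^esub> p \<oplus>\<^bsub>M\<^esub> (a \<otimes>\<^bsub>R\<^esub> r) \<odot>\<^bsub>M\<^esub> k"
      using ax x PM assms(2) by (simp add: smult_r_distr smult_assoc1)
    then show "a \<odot>\<^bsub>M\<^esub> x \<in> ?Q" using ax x P(4) by blast
  qed
qed

lemma (in module) submodule_zero: "submodule {\<zero>\<^bsub>M\<^esub>} R M"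
  by (rule submoduleI) auto

lemma (in module) fin_gen_submodule: "fin_gen R M P \<Longrightarrow> submodule P R M"
  by (induction rule: fin_gen.induct) (auto intro: submodule_zero submodule_extend)

lemma fin_gen_image:
  assumes "module R M" "module R N" "mod_hom R M N T" "fin_gen R M P"
  shows "fin_gen R N (T ` P)"
  using assms(4)
proof induction
  case zero
  then show ?case using mod_hom_zero[OF assms(1-3)] by (simp add: fin_gen.zero)
next
  case (extend P k)
  interpret M: module R M by fact
  have PM: "p \<in> carrier M" if "p \<in> P" for p
    using that M.submoduleE(1)[OF M.fin_gen_submodule[OF extend(1)]] by auto
  have T: "T (p \<oplus>\<^bsub>M\<^esub> r \<odot>\<^bsub>M\<^esub> k) = T p \<oplus>\<^bsub>N\<^esub> r \<odot>\<^bsub>N\<^esub> T k" if "p \<in> P" "r \<in> carrier R" for p r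
    using that extend(2) PM by (simp add: mod_homD[OF assms(3)])
  have "T ` {p \<oplus>\<^bsub>M\<^esub> r \<odot>\<^bsub>M\<^esub> k | p r. p \<in> P \<and> r \<in> carrier R}
    = {p \<oplus>\<^bsub>N\<^esub> r \<odot>\<^bsub>N\<^esub> T k | p r. p \<in> T ` P \<and> r \<in> carrier R}"
    (is "T ` ?A = ?B")
  proof
    show "T ` ?A \<subseteq> ?B" using T by blast
    show "?B \<subseteq> T ` ?A"
    proof
      fix x assume "x \<in> ?B"
      then obtain p r where p: "x = T p \<oplus>\<^bsub>N\<^esub> r \<odot>\<^bsub>N\<^esub> T k" "p \<in> P" "r \<in> carrier R" by blast
      then have "x = T (p \<oplus>\<^bsub>M\<^esub> r \<odot>\<^bsub>M\<^esub> k)" using T by simp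
      then show "x \<in> T ` ?A" using p by blast
    qed
  qed
  then show ?case
    using fin_gen.extend[OF extend(3)] mod_homD(1)[OF assms(3) extend(2)] by simp
qed

locale regular_ring_module = module R M
  for R :: "'a ring" and M :: "('a,'b) module" (structure) +
  assumes vnr: "von_neumann_regular R"

text \<open>The ideal \<phi>(P) is generated by an idempotent e. When k is adjoined, put a =
  \<phi>(k); the part a' = a - a e satisfies e a' = 0. If a' b a' = a', then b a' is an idempotent
  generating a' R, and the sum e + b a' of orthogonal idempotents generates e R + a R. A preimage
  \<open>v\<close> of the idempotent is recorded because the kernel is later reached by projecting
  along it.\<close>

lemma (in regular_ring_module) fin_gen_form_idempotent:
  assumes \<phi>: "mod_hom R M (regular_module R) \<phi>"
    and P: "fin_gen R M P"
  shows "\<exists>v\<in>P. \<forall>u\<in>P. \<phi> u \<otimes>\<^bsub>R\<^esub> \<phi> v = \<phi> u"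
  using P
proof induction
  case zero
  have "\<phi> \<zero>\<^bsub>M\<^esub> = \<zero>\<^bsub>R\<^esub>"
    using mod_hom_zero[OF module_axioms module_regular_module[OF is_cring] \<phi>] by simp
  then show ?case by simp
next
  case (extend P k)
  note sub = submoduleE[OF fin_gen_submodule[OF extend(1)]]
  have PM: "p \<in> carrier M" if "p \<in> P" for p using that sub(1) by auto
  note \<phi>D = mod_homD[OF \<phi>, simplified]
  obtain v where v: "v \<in> P" "\<And>u. u \<in> P \<Longrightarrow> \<phi> u \<otimes>\<^bsub>R\<^esub> \<phi> v = \<phi> u" using extend(3) by auto
  define e a where "e = \<phi> v" and "a = \<phi> k"
  have ec: "e \<in> carrier R" "a \<in> carrier R" using e_def a_def v extend(2) PM \<phi>D by auto
  have ee: "e \<otimes>\<^bsub>R\<^esub> e = e" using v e_def by auto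
  define a' where "a' = a \<oplus>\<^bsub>R\<^esub> (\<ominus>\<^bsub>R\<^esub> a) \<otimes>\<^bsub>R\<^esub> e"
  have a'c: "a' \<in> carrier R" using ec by (simp add: a'_def)
  then obtain b where b: "b \<in> carrier R" "a' \<otimes>\<^bsub>R\<^esub> b \<otimes>\<^bsub>R\<^esub> a' = a'"
    using vnr by (auto simp: von_neumann_regular_def)
  have ea': "e \<otimes>\<^bsub>R\<^esub> a' = \<zero>\<^bsub>R\<^esub>"
  proof -
    have "e \<otimes>\<^bsub>R\<^esub> a' = e \<otimes>\<^bsub>R\<^esub> a \<oplus>\<^bsub>R\<^esub> (\<ominus>\<^bsub>R\<^esub> a) \<otimes>\<^bsub>R\<^esub> (e \<otimes>\<^bsub>R\<^esub> e)"
      using ec unfolding a'_def by algebra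
    then show ?thesis using ec ee R.r_neg[of "a \<otimes>\<^bsub>R\<^esub> e"] by (simp add: R.m_ac R.l_minus R.r_minus)
  qed
  \<comment> \<open>An element of P + Rk with \<phi>(w) = e + b a': the multiple b k contributes b
    a, and subtracting b a v takes away b a e.\<close>
  define w where "w = (v \<oplus>\<^bsub>M\<^esub> (\<ominus>\<^bsub>R\<^esub> (b \<otimes>\<^bsub>R\<^esub> a)) \<odot>\<^bsub>M\<^esub> v) \<oplus>\<^bsub>M\<^esub> b \<odot>\<^bsub>M\<^esub> k"
  have \<phi>w: "\<phi> w = e \<oplus>\<^bsub>R\<^esub> b \<otimes>\<^bsub>R\<^esub> a'"
  proof -
    have "\<phi> w = (e \<oplus>\<^bsub>R\<^esub> (\<ominus>\<^bsub>R\<^esub> (b \<otimes>\<^bsub>R\<^esub> a)) \<otimes>\<^bsub>R\<^esub> e) \<oplus>\<^bsub>R\<^esub> b \<otimes>\<^bsub>R\<^esub> a"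
      unfolding w_def e_def a_def using v(1) PM b ec extend(2) by (simp add: \<phi>D)
    then show ?thesis using ec b(1) unfolding a'_def by algebra
  qed
  show ?case
  proof (intro bexI[of _ w] ballI)
    show "w \<in> {p \<oplus>\<^bsub>M\<^esub> r \<odot>\<^bsub>M\<^esub> k | p r. p \<in> P \<and> r \<in> carrier R}"
      unfolding w_def using v(1) b ec
      by (intro CollectI exI[of _ "v \<oplus>\<^bsub>M\<^esub> (\<ominus>\<^bsub>R\<^esub> (b \<otimes>\<^bsub>R\<^esub> a)) \<odot>\<^bsub>M\<^esub> v"] exI[of _ b] conjI refl sub(4,5)) auto
    fix u assume "u \<in> {p \<oplus>\<^bsub>M\<^esub> r \<odot>\<^bsub>M\<^esub> k | p r. p \<in> P \<and> r \<in> carrier R}"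
    then obtain p r where u: "u = p \<oplus>\<^bsub>M\<^esub> r \<odot>\<^bsub>M\<^esub> k" "p \<in> P" "r \<in> carrier R" by auto
    define c where "c = \<phi> p"
    have c: "c \<in> carrier R" "c \<otimes>\<^bsub>R\<^esub> e = c" using u v PM \<phi>D by (auto simp: c_def e_def)
    have cc: "c \<otimes>\<^bsub>R\<^esub> \<phi> w = c"
    proof -
      have "c \<otimes>\<^bsub>R\<^esub> \<phi> w = c \<otimes>\<^bsub>R\<^esub> e \<oplus>\<^bsub>R\<^esub> (c \<otimes>\<^bsub>R\<^esub> e) \<otimes>\<^bsub>R\<^esub> (b \<otimes>\<^bsub>R\<^esub> a')"
        unfolding \<phi>w using c ec b a'c by (simp add: R.r_distr)
      also have "\<dots> = c \<otimes>\<^bsub>R\<^esub> e \<oplus>\<^bsub>R\<^esub> (c \<otimes>\<^bsub>R\<^esub> b) \<otimes>\<^bsub>R\<^esub> (e \<otimes>\<^bsub>R\<^esub> a')"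
        using c(1) ec b(1) a'c by (simp add: R.m_ac)
      finally show ?thesis using ea' c b by simp
    qed
    have aa: "a \<otimes>\<^bsub>R\<^esub> \<phi> w = a"
    proof -
      \<comment> \<open>The decomposition of a into its part in e R and its part orthogonal to e;
        the first is fixed by e, the second by b a'.\<close>
      have a: "a = a \<otimes>\<^bsub>R\<^esub> e \<oplus>\<^bsub>R\<^esub> a'" unfolding a'_def using ec by algebra
      have "a \<otimes>\<^bsub>R\<^esub> \<phi> w = a \<otimes>\<^bsub>R\<^esub> e \<oplus>\<^bsub>R\<^esub> (a \<otimes>\<^bsub>R\<^esub> e \<oplus>\<^bsub>R\<^esub> a') \<otimes>\<^bsub>R\<^esub> (b \<otimes>\<^bsub>R\<^esub> a')"
        unfolding \<phi>w using ec b(1) a'c a[symmetric] by (simp add: R.r_distr)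
      also have "\<dots> = a \<otimes>\<^bsub>R\<^esub> e \<oplus>\<^bsub>R\<^esub> (a \<otimes>\<^bsub>R\<^esub> b \<otimes>\<^bsub>R\<^esub> (e \<otimes>\<^bsub>R\<^esub> a') \<oplus>\<^bsub>R\<^esub> a' \<otimes>\<^bsub>R\<^esub> b \<otimes>\<^bsub>R\<^esub> a')"
        using ec b(1) a'c by algebra
      also have "\<dots> = a \<otimes>\<^bsub>R\<^esub> e \<oplus>\<^bsub>R\<^esub> a'" using ea' b a'c ec by simp
      finally show ?thesis using a[symmetric] by simp
    qed
    have wc: "\<phi> w \<in> carrier R" using \<phi>w ec b a'c by simp
    have \<phi>u: "\<phi> u = c \<oplus>\<^bsub>R\<^esub> r \<otimes>\<^bsub>R\<^esub> a"
      unfolding u c_def a_def using u PM extend(2) by (simp add: \<phi>D)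
    have "\<phi> u \<otimes>\<^bsub>R\<^esub> \<phi> w = c \<otimes>\<^bsub>R\<^esub> \<phi> w \<oplus>\<^bsub>R\<^esub> r \<otimes>\<^bsub>R\<^esub> (a \<otimes>\<^bsub>R\<^esub> \<phi> w)"
      unfolding \<phi>u using u c ec wc by (simp add: R.l_distr R.m_assoc)
    then show "\<phi> u \<otimes>\<^bsub>R\<^esub> \<phi> w = \<phi> u" using cc aa \<phi>u by simp
  qed
qed

text \<open>With \<open>v\<close> from the previous lemma, u \<mapsto> u - \<phi>(u) v maps P into
  the kernel and fixes the kernel pointwise. The kernel is therefore a linear image of P and
  inherits finite generation.\<close>

lemma (in regular_ring_module) fin_gen_form_kernel:
  assumes \<phi>: "mod_hom R M (regular_module R) \<phi>"
    and P: "fin_gen R M P"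
  shows "fin_gen R M {u \<in> P. \<phi> u = \<zero>\<^bsub>R\<^esub>}"
proof -
  note sub = submoduleE[OF fin_gen_submodule[OF P]]
  have PM: "p \<in> carrier M" if "p \<in> P" for p using that sub(1) by auto
  note \<phi>D = mod_homD[OF \<phi>, simplified]
  obtain v where v: "v \<in> P" "\<And>u. u \<in> P \<Longrightarrow> \<phi> u \<otimes>\<^bsub>R\<^esub> \<phi> v = \<phi> u"
    using fin_gen_form_idempotent[OF assms] by auto
  have vM: "v \<in> carrier M" using v PM by auto
  define T where "T u = u \<oplus>\<^bsub>M\<^esub> (\<ominus>\<^bsub>R\<^esub> \<phi> u) \<odot>\<^bsub>M\<^esub> v" for u
  have T: "mod_hom R M M T"
  proof (rule mod_homI)
    fix x assume x: "x \<in> carrier M"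
    then show "T x \<in> carrier M" using vM by (simp add: T_def \<phi>D)
    fix r assume r: "r \<in> carrier R"
    have "\<ominus>\<^bsub>R\<^esub> (r \<otimes>\<^bsub>R\<^esub> \<phi> x) = r \<otimes>\<^bsub>R\<^esub> (\<ominus>\<^bsub>R\<^esub> \<phi> x)" using r x \<phi>D by (simp add: R.r_minus)
    then show "T (r \<odot>\<^bsub>M\<^esub> x) = r \<odot>\<^bsub>M\<^esub> T x"
      using x r vM \<phi>D by (simp add: T_def smult_r_distr smult_assoc1)
  next
    fix x y assume xy: "x \<in> carrier M" "y \<in> carrier M"
    have "\<ominus>\<^bsub>R\<^esub> (\<phi> x \<oplus>\<^bsub>R\<^esub> \<phi> y) = \<ominus>\<^bsub>R\<^esub> \<phi> x \<oplus>\<^bsub>R\<^esub> \<ominus>\<^bsub>R\<^esub> \<phi> y" using xy \<phi>D by (simp add: R.minus_add)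
    then show "T (x \<oplus>\<^bsub>M\<^esub> y) = T x \<oplus>\<^bsub>M\<^esub> T y"
      using xy vM \<phi>D by (simp add: T_def smult_l_distr M.a_ac)
  qed
  have "T ` P = {u \<in> P. \<phi> u = \<zero>\<^bsub>R\<^esub>}"
  proof (intro equalityI subsetI)
    fix y assume "y \<in> T ` P"
    then obtain u where u: "u \<in> P" "y = T u" by auto
    have "\<phi> y = \<phi> u \<oplus>\<^bsub>R\<^esub> (\<ominus>\<^bsub>R\<^esub> \<phi> u) \<otimes>\<^bsub>R\<^esub> \<phi> v" using u PM vM by (simp add: T_def \<phi>D)
    also have "\<dots> = \<zero>\<^bsub>R\<^esub>" using u PM vM v(2) \<phi>D by (simp add: R.l_minus R.r_neg)
    finally show "y \<in> {u \<in> P. \<phi> u = \<zero>\<^bsub>R\<^esub>}"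
      using u v(1) sub(4,5) \<phi>D PM by (simp add: T_def)
  next
    fix y assume "y \<in> {u \<in> P. \<phi> u = \<zero>\<^bsub>R\<^esub>}"
    then have "y \<in> P" "T y = y" using vM PM by (auto simp: T_def)
    then show "y \<in> T ` P" by force
  qed
  then show ?thesis using fin_gen_image[OF module_axioms module_axioms T P] by simp
qed

section \<open>Quotients and products of modules\<close>

text \<open>The quotient of M by the fibres of \<open>q\<close>, carried by the values of
  \<open>q\<close> instead of by cosets. A suitable \<open>q\<close> thus gives the quotient any
  desired element type, in particular the one that \<open>ext1_vanishes\<close> demands.\<close>

definition image_module :: "('a,'b) module \<Rightarrow> ('b \<Rightarrow> 'd) \<Rightarrow> ('a,'d) module" where
  "image_module M q =
     \<lparr>carrier = q ` carrier M,
      mult = (\<lambda>X Y. q \<zero>\<^bsub>M\<^esub>),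
      one = q \<zero>\<^bsub>M\<^esub>,
      zero = q \<zero>\<^bsub>M\<^esub>,
      add = (\<lambda>X Y. q (inv_into (carrier M) q X \<oplus>\<^bsub>M\<^esub> inv_into (carrier M) q Y)),
      smult = (\<lambda>r X. q (r \<odot>\<^bsub>M\<^esub> inv_into (carrier M) q X))\<rparr>"

text \<open>The assumptions make the fibres of \<open>q\<close> a congruence, so the operations do
  not depend on the preimages picked by \<open>inv_into\<close> and the module laws descend from
  M.\<close>

lemma
  fixes R :: "'a ring" and M :: "('a,'b) module" and q :: "'b \<Rightarrow> 'd"
  assumes "module R M"
    and add_cong: "\<And>x x' y y'. x \<in> carrier M \<Longrightarrow> x' \<in> carrier M \<Longrightarrow> y \<in> carrier M \<Longrightarrow>
      y' \<in> carrier M \<Longrightarrow> q x = q x' \<Longrightarrow> q y = q y' \<Longrightarrow> q (x \<oplus>\<^bsub>M\<^esub> y) = q (x' \<oplus>\<^bsub>M\<^esub> y')"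
    and smult_cong: "\<And>r x x'. r \<in> carrier R \<Longrightarrow> x \<in> carrier M \<Longrightarrow> x' \<in> carrier M \<Longrightarrow>
      q x = q x' \<Longrightarrow> q (r \<odot>\<^bsub>M\<^esub> x) = q (r \<odot>\<^bsub>M\<^esub> x')"
  shows module_image_module: "module R (image_module M q)" (is "module R ?Q")
    and mod_hom_image_module: "mod_hom R M (image_module M q) q"
proof -
  interpret M: module R M by fact
  have inv: "inv_into (carrier M) q (q x) \<in> carrier M" "q (inv_into (carrier M) q (q x)) = q x"
    if "x \<in> carrier M" for x
    using that by (auto intro: inv_into_into f_inv_into_f)
  have carr: "carrier ?Q = q ` carrier M" and zero: "\<zero>\<^bsub>?Q\<^esub> = q \<zero>\<^bsub>M\<^esub>"
    by (simp_all add: image_module_def)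
  have add: "q x \<oplus>\<^bsub>?Q\<^esub> q y = q (x \<oplus>\<^bsub>M\<^esub> y)" if "x \<in> carrier M" "y \<in> carrier M" for x y
    unfolding image_module_def using that inv by simp (rule add_cong)
  have smult: "r \<odot>\<^bsub>?Q\<^esub> q x = q (r \<odot>\<^bsub>M\<^esub> x)" if "r \<in> carrier R" "x \<in> carrier M" for r x
    unfolding image_module_def using that inv by simp (rule smult_cong)
  show "mod_hom R M ?Q q"
    by (rule mod_homI) (auto simp: carr add smult)
  show "module R ?Q"
  proof (rule moduleI[OF M.is_cring abelian_groupI])
    fix X assume "X \<in> carrier ?Q"
    then obtain x where x: "x \<in> carrier M" "X = q x" by (auto simp: carr)
    show "\<exists>Y\<in>carrier ?Q. Y \<oplus>\<^bsub>?Q\<^esub> X = \<zero>\<^bsub>?Q\<^esub>"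
      using x by (intro bexI[of _ "q (\<ominus>\<^bsub>M\<^esub> x)"]) (auto simp: carr zero add M.M.l_neg)
  qed (auto simp: carr zero add smult M.M.a_ac M.smult_l_distr M.smult_r_distr M.smult_assoc1)
qed

text \<open>Serves to form C \<oplus> R, of which the pushout below is a quotient.\<close>

definition prod_module :: "('a,'b) module \<Rightarrow> ('a,'d) module \<Rightarrow> ('a,'b \<times> 'd) module" where
  "prod_module M N =
     \<lparr>carrier = carrier M \<times> carrier N,
      mult = (\<lambda>x y. (\<zero>\<^bsub>M\<^esub>, \<zero>\<^bsub>N\<^esub>)),
      one = (\<zero>\<^bsub>M\<^esub>, \<zero>\<^bsub>N\<^esub>),
      zero = (\<zero>\<^bsub>M\<^esub>, \<zero>\<^bsub>N\<^esub>),
      add = (\<lambda>x y. (fst x \<oplus>\<^bsub>M\<^esub> fst y, snd x \<oplus>\<^bsub>N\<^esub> snd y)),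
      smult = (\<lambda>r x. (r \<odot>\<^bsub>M\<^esub> fst x, r \<odot>\<^bsub>N\<^esub> snd x))\<rparr>"

lemma prod_module_simps [simp]:
  "carrier (prod_module M N) = carrier M \<times> carrier N"
  "\<zero>\<^bsub>prod_module M N\<^esub> = (\<zero>\<^bsub>M\<^esub>, \<zero>\<^bsub>N\<^esub>)"
  "x \<oplus>\<^bsub>prod_module M N\<^esub> y = (fst x \<oplus>\<^bsub>M\<^esub> fst y, snd x \<oplus>\<^bsub>N\<^esub> snd y)"
  "r \<odot>\<^bsub>prod_module M N\<^esub> x = (r \<odot>\<^bsub>M\<^esub> fst x, r \<odot>\<^bsub>N\<^esub> snd x)"
  by (simp_all add: prod_module_def)

lemma module_prod_module:
  assumes "module R M" "module R N"
  shows "module R (prod_module M N)"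
proof -
  interpret M: module R M by fact
  interpret N: module R N by fact
  show ?thesis
  proof (rule moduleI[OF M.is_cring abelian_groupI])
    fix x assume "x \<in> carrier (prod_module M N)"
    then show "\<exists>y\<in>carrier (prod_module M N). y \<oplus>\<^bsub>prod_module M N\<^esub> x = \<zero>\<^bsub>prod_module M N\<^esub>"
      by (intro bexI[of _ "(\<ominus>\<^bsub>M\<^esub> fst x, \<ominus>\<^bsub>N\<^esub> snd x)"]) (auto simp: M.M.l_neg N.M.l_neg)
  qed (auto simp: M.M.a_ac M.smult_l_distr M.smult_r_distr M.smult_assoc1
      N.M.a_ac N.smult_l_distr N.smult_r_distr N.smult_assoc1)
qed

section \<open>Localizations that are quotients\<close>

text \<open>Under these assumptions $I$ is the kernel of $R \to S^{-1}R$ and this map is surjective,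
  so that $S^{-1}R \cong R/I$.\<close>
locale surjective_localization = cring R for R :: "'a ring" (structure) +
  fixes I S
  assumes I: "ideal I R"
    and S: "mult_subset R S"
    and one_minus: "s \<in> S \<Longrightarrow> \<one> \<ominus> s \<in> I"
    and killed: "x \<in> I \<Longrightarrow> \<exists>t\<in>S. t \<otimes> x = \<zero>"
begin

lemma S_closed: "s \<in> S \<Longrightarrow> s \<in> carrier R" "\<one> \<in> S" "s \<in> S \<Longrightarrow> t \<in> S \<Longrightarrow> s \<otimes> t \<in> S"
  using S by (auto simp: mult_subset_def)

lemma I_closed:
  "x \<in> I \<Longrightarrow> x \<in> carrier R" "\<zero> \<in> I"
  "x \<in> I \<Longrightarrow> y \<in> I \<Longrightarrow> x \<oplus> y \<in> I" "x \<in> I \<Longrightarrow> y \<in> I \<Longrightarrow> x \<ominus> y \<in> I"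
  "x \<in> I \<Longrightarrow> \<ominus> x \<in> I" "x \<in> I \<Longrightarrow> r \<in> carrier R \<Longrightarrow> r \<otimes> x \<in> I"
proof -
  interpret ideal I R by (rule I)
  show "x \<in> I \<Longrightarrow> x \<in> carrier R" "\<zero> \<in> I"
    "x \<in> I \<Longrightarrow> y \<in> I \<Longrightarrow> x \<oplus> y \<in> I"
    "x \<in> I \<Longrightarrow> \<ominus> x \<in> I" "x \<in> I \<Longrightarrow> r \<in> carrier R \<Longrightarrow> r \<otimes> x \<in> I"
    by (auto simp: I_l_closed)
  then show "x \<in> I \<Longrightarrow> y \<in> I \<Longrightarrow> x \<ominus> y \<in> I"
    unfolding a_minus_def by auto
qed

text \<open>Every s in S is 1 modulo I, so r s' - r' s and r - r' agree modulo I. An element killed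
  by some t in S lies in I because t is 1 modulo I, and the converse is \<open>killed\<close>.
  Denominators thus drop out of the relation.\<close>

lemma loc_rel_iff:
  "((r, s), (r', s')) \<in> loc_rel R S \<longleftrightarrow>
     r \<in> carrier R \<and> s \<in> S \<and> r' \<in> carrier R \<and> s' \<in> S \<and> r \<ominus> r' \<in> I"
proof (cases "r \<in> carrier R \<and> s \<in> S \<and> r' \<in> carrier R \<and> s' \<in> S")
  case True
  then have c: "r \<in> carrier R" "s \<in> carrier R" "r' \<in> carrier R" "s' \<in> carrier R"
    using S_closed by auto
  define d where "d = r \<otimes> s' \<ominus> r' \<otimes> s"
  have dc: "d \<in> carrier R" using c by (simp add: d_def)
  \<comment> \<open>The error made by dropping the denominators from d; it lies in I since 1 - s and
    1 - s' do.\<close>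
  define j where "j = r \<otimes> (\<one> \<ominus> s') \<ominus> r' \<otimes> (\<one> \<ominus> s)"
  have jI: "j \<in> I" using True c by (auto simp: j_def intro!: I_closed one_minus)
  have jc: "j \<in> carrier R" using jI I_closed by auto
  have rd: "r \<ominus> r' = d \<oplus> j" unfolding d_def j_def using c by algebra
  have dr: "d = (r \<ominus> r') \<ominus> j" unfolding d_def j_def using c by algebra
  have "(\<exists>t\<in>S. t \<otimes> d = \<zero>) \<longleftrightarrow> d \<in> I"
  proof
    assume "\<exists>t\<in>S. t \<otimes> d = \<zero>"
    then obtain t where t: "t \<in> S" "t \<otimes> d = \<zero>" by auto
    have tc: "t \<in> carrier R" using t S_closed by auto
    have "d = d \<otimes> (\<one> \<ominus> t) \<oplus> t \<otimes> d" using dc tc by algebra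
    then have "d = d \<otimes> (\<one> \<ominus> t)" using t dc tc by simp
    moreover have "d \<otimes> (\<one> \<ominus> t) \<in> I" using t dc by (auto intro!: I_closed one_minus)
    ultimately show "d \<in> I" by simp
  qed (rule killed)
  also have "d \<in> I \<longleftrightarrow> r \<ominus> r' \<in> I"
    using rd dr jI I_closed by metis
  finally show ?thesis using True by (simp add: loc_rel_def d_def)
qed (auto simp: loc_rel_def)

definition frac :: "'a \<Rightarrow> ('a \<times> 'a) set" where
  "frac r = loc_rel R S `` {(r, \<one>)}"

lemma frac_mem: "r \<in> carrier R \<Longrightarrow> (r', s') \<in> frac r \<longleftrightarrow> r' \<in> carrier R \<and> s' \<in> S \<and> r \<ominus> r' \<in> I"
  by (simp add: frac_def loc_rel_iff S_closed)

lemma minus_mem_sym: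
  assumes "r \<in> carrier R" "r' \<in> carrier R" "r \<ominus> r' \<in> I" shows "r' \<ominus> r \<in> I"
proof -
  have "r' \<ominus> r = \<ominus> (r \<ominus> r')" using assms(1,2) by algebra
  then show ?thesis using I_closed(5)[OF assms(3)] by simp
qed

lemma minus_mem_trans:
  assumes "r \<in> carrier R" "r' \<in> carrier R" "r'' \<in> carrier R" "r \<ominus> r' \<in> I" "r' \<ominus> r'' \<in> I"
  shows "r \<ominus> r'' \<in> I"
proof -
  have "r \<ominus> r'' = (r \<ominus> r') \<oplus> (r' \<ominus> r'')" using assms(1-3) by algebra
  then show ?thesis using I_closed(3)[OF assms(4,5)] by simp
qed

text \<open>Since denominators are irrelevant, every fraction is of the form r/1. This gives
  surjectivity of R \<rightarrow> S^{-1}R and evaluates the operations of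
  \<open>loc_module\<close>.\<close>

lemma class_eq_frac:
  assumes "r \<in> carrier R" "r' \<in> carrier R" "s' \<in> S" "r \<ominus> r' \<in> I"
  shows "loc_rel R S `` {(r', s')} = frac r"
proof -
  have "(x, s) \<in> loc_rel R S `` {(r', s')} \<longleftrightarrow> (x, s) \<in> frac r" for x s
    using assms minus_mem_trans[of r r' x] minus_mem_trans[of r' r x] minus_mem_sym[of r r']
    by (auto simp: frac_mem loc_rel_iff)
  then show ?thesis by auto
qed

lemma minus_self_mem: "r \<in> carrier R \<Longrightarrow> r \<ominus> r \<in> I"
  using I_closed by (simp add: a_minus_def r_neg)

lemma frac_eq_iff:
  assumes "r \<in> carrier R" "r' \<in> carrier R"
  shows "frac r = frac r' \<longleftrightarrow> r \<ominus> r' \<in> I"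
proof
  assume "frac r = frac r'"
  moreover have "(r', \<one>) \<in> frac r'" using assms minus_self_mem by (simp add: frac_mem S_closed)
  ultimately show "r \<ominus> r' \<in> I" using assms frac_mem by auto
next
  assume "r \<ominus> r' \<in> I"
  then show "frac r = frac r'"
    using class_eq_frac[OF assms S_closed(2)] by (simp add: frac_def)
qed

lemma carrier_loc_module: "carrier (loc_module R S) = frac ` carrier R"
proof (intro equalityI subsetI)
  fix X assume "X \<in> carrier (loc_module R S)"
  then obtain r s where "r \<in> carrier R" "s \<in> S" "X = loc_rel R S `` {(r, s)}"
    by (auto simp: loc_module_def quotient_def)
  then show "X \<in> frac ` carrier R" using class_eq_frac[of r r s] minus_self_mem by auto
next
  fix X assume "X \<in> frac ` carrier R"
  then show "X \<in> carrier (loc_module R S)"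
    using S_closed by (auto simp: loc_module_def frac_def intro!: quotientI)
qed

lemma zero_loc_module: "\<zero>\<^bsub>loc_module R S\<^esub> = frac \<zero>"
  by (simp add: loc_module_def frac_def)

text \<open>All that can be said about the representative chosen by \<open>rep\<close>: its
  numerator is determined modulo I, its denominator is some element of S.\<close>

lemma rep_frac:
  assumes "r \<in> carrier R"
  obtains r' s' where "rep (frac r) = (r', s')" "r' \<in> carrier R" "s' \<in> S" "r \<ominus> r' \<in> I"
proof -
  have "(r, \<one>) \<in> frac r" using assms minus_self_mem by (simp add: frac_mem S_closed)
  then have "rep (frac r) \<in> frac r" unfolding rep_def by (rule someI)
  then show ?thesis using that frac_mem[OF assms] by (cases "rep (frac r)") auto
qed

lemma add_loc_module:
  assumes "r \<in> carrier R" "t \<in> carrier R"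
  shows "frac r \<oplus>\<^bsub>loc_module R S\<^esub> frac t = frac (r \<oplus> t)"
proof -
  obtain r' s where r: "rep (frac r) = (r', s)" "r' \<in> carrier R" "s \<in> S" "r \<ominus> r' \<in> I"
    using rep_frac assms by metis
  obtain t' s' where t: "rep (frac t) = (t', s')" "t' \<in> carrier R" "s' \<in> S" "t \<ominus> t' \<in> I"
    using rep_frac assms by metis
  have sc: "s \<in> carrier R" "s' \<in> carrier R" using r t S_closed by auto
  have "(r \<oplus> t) \<ominus> (r' \<otimes> s' \<oplus> t' \<otimes> s)
     = (r \<ominus> r') \<oplus> (t \<ominus> t') \<oplus> (r' \<otimes> (\<one> \<ominus> s') \<oplus> t' \<otimes> (\<one> \<ominus> s))"
    using assms r(2) t(2) sc by algebra
  also have "\<dots> \<in> I" using r t by (auto intro!: I_closed one_minus)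
  finally have "loc_rel R S `` {(r' \<otimes> s' \<oplus> t' \<otimes> s, s \<otimes> s')} = frac (r \<oplus> t)"
    using assms r t sc by (intro class_eq_frac) (auto intro: S_closed)
  then show ?thesis using r t by (simp add: loc_module_def)
qed

lemma smult_loc_module:
  assumes "a \<in> carrier R" "r \<in> carrier R"
  shows "a \<odot>\<^bsub>loc_module R S\<^esub> frac r = frac (a \<otimes> r)"
proof -
  obtain r' s where r: "rep (frac r) = (r', s)" "r' \<in> carrier R" "s \<in> S" "r \<ominus> r' \<in> I"
    using rep_frac assms by metis
  have "a \<otimes> r \<ominus> a \<otimes> r' = a \<otimes> (r \<ominus> r')" using assms r(2) by algebra
  also have "\<dots> \<in> I" using r assms by (auto intro!: I_closed)
  finally have "loc_rel R S `` {(a \<otimes> r', s)} = frac (a \<otimes> r)"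
    using assms r by (intro class_eq_frac) auto
  then show ?thesis using r by (simp add: loc_module_def)
qed

text \<open>A form of $\mathrm{Ext}^1(R/I, C) = 0$: apply the splitting to the pushout of
  $0 \to I \to R \to R/I \to 0$ along $h$, realised on the set $C \times S^{-1}R$ by means of
  a set-theoretic section of $R \to S^{-1}R$.\<close>
lemma extend_from_ideal:
  fixes C :: "('a,'c) module"
  assumes "module R C" and ext: "ext1_vanishes R (loc_module R S) C"
    and h: "\<And>x. x \<in> I \<Longrightarrow> h x \<in> carrier C"
      "\<And>x y. x \<in> I \<Longrightarrow> y \<in> I \<Longrightarrow> h (x \<oplus> y) = h x \<oplus>\<^bsub>C\<^esub> h y"
      "\<And>r x. r \<in> carrier R \<Longrightarrow> x \<in> I \<Longrightarrow> h (r \<otimes> x) = r \<odot>\<^bsub>C\<^esub> h x"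
  shows "\<exists>c\<in>carrier C. \<forall>x\<in>I. h x = x \<odot>\<^bsub>C\<^esub> c"
proof -
  interpret C: module R C by fact
  \<comment> \<open>The set-theoretic section, seen as a choice of one representative in each class
    modulo I.\<close>
  define \<rho> where "\<rho> r = inv_into (carrier R) frac (frac r)" for r
  have \<rho>: "\<rho> r \<in> carrier R" "r \<ominus> \<rho> r \<in> I" if "r \<in> carrier R" for r
  proof -
    show c: "\<rho> r \<in> carrier R" unfolding \<rho>_def using that by (intro inv_into_into) auto
    have "frac (\<rho> r) = frac r" unfolding \<rho>_def using that by (intro f_inv_into_f) auto
    then show "r \<ominus> \<rho> r \<in> I" using frac_eq_iff c that by metis
  qed
  define M where "M = prod_module C (regular_module R)"
  have M: "module R M"
    unfolding M_def by (intro module_prod_module module_regular_module assms is_cring)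
  \<comment> \<open>A normal form for C \<oplus> R modulo the elements (h(i), -i) with i in I: the
    second entry r is moved to its representative \<rho>(r) and h of the difference is added to the
    first. Recording the class of r in place of \<rho>(r) makes the values have the element type
    prescribed by \<open>ext1_vanishes\<close>.\<close>
  define q where "q x = (fst x \<oplus>\<^bsub>C\<^esub> h (snd x \<ominus> \<rho> (snd x)), frac (snd x))" for x :: "'c \<times> 'a"
  have q_eq: "q (c, r) = q (c', r') \<longleftrightarrow> (r \<ominus> r' \<in> I \<and> c' = c \<oplus>\<^bsub>C\<^esub> h (r \<ominus> r'))"
    if "c \<in> carrier C" "c' \<in> carrier C" "r \<in> carrier R" "r' \<in> carrier R" for c c' r r'
  proof (cases "r \<ominus> r' \<in> I")
    case True
    then have fr: "frac r = frac r'" using frac_eq_iff that by auto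
    then have \<rho>\<rho>: "\<rho> r = \<rho> r'" by (simp add: \<rho>_def)
    note r' = \<rho>(2)[OF that(4)]
    have "r \<ominus> \<rho> r = (r \<ominus> r') \<oplus> (r' \<ominus> \<rho> r')"
      unfolding \<rho>\<rho> using that(3,4) \<rho>(1)[OF that(4)] by algebra
    then have "h (r \<ominus> \<rho> r) = h (r \<ominus> r') \<oplus>\<^bsub>C\<^esub> h (r' \<ominus> \<rho> r')"
      using h(2)[OF True r'] by simp
    then have "c \<oplus>\<^bsub>C\<^esub> h (r \<ominus> \<rho> r) = (c \<oplus>\<^bsub>C\<^esub> h (r \<ominus> r')) \<oplus>\<^bsub>C\<^esub> h (r' \<ominus> \<rho> r')"
      using that h(1)[OF True] h(1)[OF r'] by (simp add: C.M.a_assoc)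
    then show ?thesis
      using True fr that h(1)[OF True] h(1)[OF r'] by (auto simp: q_def)
  next
    case False
    then show ?thesis using frac_eq_iff that by (auto simp: q_def)
  qed
  have hz: "h \<zero> = \<zero>\<^bsub>C\<^esub>" using h(3)[of \<zero> \<zero>] h(1)[of \<zero>] I_closed by simp
  have add_cong: "q (x \<oplus>\<^bsub>M\<^esub> y) = q (x' \<oplus>\<^bsub>M\<^esub> y')"
    if "x \<in> carrier M" "x' \<in> carrier M" "y \<in> carrier M" "y' \<in> carrier M" "q x = q x'" "q y = q y'"
    for x x' y y'
  proof -
    obtain c r c' r' d s d' s' where [simp]: "x = (c, r)" "x' = (c', r')" "y = (d, s)" "y' = (d', s')"
      by (metis surj_pair)
    have m: "c \<in> carrier C" "c' \<in> carrier C" "r \<in> carrier R" "r' \<in> carrier R"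
      "d \<in> carrier C" "d' \<in> carrier C" "s \<in> carrier R" "s' \<in> carrier R"
      using that by (auto simp: M_def)
    have i: "r \<ominus> r' \<in> I" "s \<ominus> s' \<in> I" and e: "c' = c \<oplus>\<^bsub>C\<^esub> h (r \<ominus> r')" "d' = d \<oplus>\<^bsub>C\<^esub> h (s \<ominus> s')"
      using that(5,6) q_eq m by auto
    have s: "(r \<oplus> s) \<ominus> (r' \<oplus> s') = (r \<ominus> r') \<oplus> (s \<ominus> s')" using m by algebra
    have "q (c \<oplus>\<^bsub>C\<^esub> d, r \<oplus> s) = q (c' \<oplus>\<^bsub>C\<^esub> d', r' \<oplus> s')"
      using m i h(1)[OF i(1)] h(1)[OF i(2)] unfolding e
      by (subst q_eq) (auto simp: s h(2) C.M.a_ac I_closed)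
    then show ?thesis by (simp add: M_def)
  qed
  have smult_cong: "q (a \<odot>\<^bsub>M\<^esub> x) = q (a \<odot>\<^bsub>M\<^esub> x')"
    if "a \<in> carrier R" "x \<in> carrier M" "x' \<in> carrier M" "q x = q x'" for a x x'
  proof -
    obtain c r c' r' where [simp]: "x = (c, r)" "x' = (c', r')"
      by (metis surj_pair)
    have m: "c \<in> carrier C" "c' \<in> carrier C" "r \<in> carrier R" "r' \<in> carrier R"
      using that by (auto simp: M_def)
    have i: "r \<ominus> r' \<in> I" and e: "c' = c \<oplus>\<^bsub>C\<^esub> h (r \<ominus> r')"
      using that(4) q_eq m by auto
    have s: "a \<otimes> r \<ominus> a \<otimes> r' = a \<otimes> (r \<ominus> r')" using m that(1) by algebra
    have "q (a \<odot>\<^bsub>C\<^esub> c, a \<otimes> r) = q (a \<odot>\<^bsub>C\<^esub> c', a \<otimes> r')"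
      using m i h(1)[OF i] that(1) unfolding e
      by (subst q_eq) (auto simp: s h(3) C.smult_r_distr I_closed)
    then show ?thesis by (simp add: M_def)
  qed
  define B where "B = image_module M q"
  have B: "module R B" unfolding B_def by (rule module_image_module[OF M add_cong smult_cong])
  have q: "mod_hom R M B q" unfolding B_def by (rule mod_hom_image_module[OF M add_cong smult_cong])
  note qD = mod_homD[OF q]
  have carr: "carrier B = q ` carrier M" by (simp add: B_def image_module_def)
  have zeroB: "\<zero>\<^bsub>B\<^esub> = q (\<zero>\<^bsub>C\<^esub>, \<zero>)" by (simp add: B_def image_module_def M_def)
  define f where "f c = q (c, \<zero>)" for c
  have f: "mod_hom R C B f"
  proof (rule mod_homI)
    fix x assume x: "x \<in> carrier C"
    then show "f x \<in> carrier B" using qD(1) by (simp add: f_def M_def)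
    fix r assume r: "r \<in> carrier R"
    then show "f (r \<odot>\<^bsub>C\<^esub> x) = r \<odot>\<^bsub>B\<^esub> f x" using x qD(3)[OF r, of "(x, \<zero>)"] by (simp add: f_def M_def)
  next
    fix x y assume "x \<in> carrier C" "y \<in> carrier C"
    then show "f (x \<oplus>\<^bsub>C\<^esub> y) = f x \<oplus>\<^bsub>B\<^esub> f y"
      using qD(2)[of "(x, \<zero>)" "(y, \<zero>)"] by (simp add: f_def M_def)
  qed
  have sq: "snd (q (c, r)) = frac r" for c r by (simp add: q_def)
  have g: "mod_hom R B (loc_module R S) snd"
  proof (rule mod_homI)
    fix X assume "X \<in> carrier B"
    then obtain c r where X: "c \<in> carrier C" "r \<in> carrier R" "X = q (c, r)"
      by (auto simp: carr M_def)
    then show "snd X \<in> carrier (loc_module R S)" by (auto simp: sq carrier_loc_module)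
    fix a assume a: "a \<in> carrier R"
    have "a \<odot>\<^bsub>B\<^esub> X = q (a \<odot>\<^bsub>C\<^esub> c, a \<otimes> r)"
      using X a qD(3)[OF a, of "(c, r)"] by (simp add: M_def)
    then show "snd (a \<odot>\<^bsub>B\<^esub> X) = a \<odot>\<^bsub>loc_module R S\<^esub> snd X"
      using X a by (simp add: sq smult_loc_module)
  next
    fix X Y assume "X \<in> carrier B" "Y \<in> carrier B"
    then obtain c r d s where X: "c \<in> carrier C" "r \<in> carrier R" "X = q (c, r)"
      "d \<in> carrier C" "s \<in> carrier R" "Y = q (d, s)"
      by (auto simp: carr M_def)
    have "X \<oplus>\<^bsub>B\<^esub> Y = q (c \<oplus>\<^bsub>C\<^esub> d, r \<oplus> s)"
      using X qD(2)[of "(c, r)" "(d, s)"] by (simp add: M_def)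
    then show "snd (X \<oplus>\<^bsub>B\<^esub> Y) = snd X \<oplus>\<^bsub>loc_module R S\<^esub> snd Y"
      using X by (simp add: sq add_loc_module)
  qed
  have inj: "inj_on f (carrier C)"
  proof (rule inj_onI)
    fix x y assume "x \<in> carrier C" "y \<in> carrier C" "f x = f y"
    then show "x = y" using q_eq[of x y \<zero> \<zero>] hz by (simp add: f_def a_minus_def)
  qed
  have surj: "snd ` carrier B = carrier (loc_module R S)"
  proof
    show "snd ` carrier B \<subseteq> carrier (loc_module R S)" using mod_homD(1)[OF g] by auto
    show "carrier (loc_module R S) \<subseteq> snd ` carrier B"
    proof
      fix X assume "X \<in> carrier (loc_module R S)"
      then obtain r where r: "r \<in> carrier R" "X = frac r" by (auto simp: carrier_loc_module)
      then have "q (\<zero>\<^bsub>C\<^esub>, r) \<in> carrier B" using qD(1) by (simp add: M_def)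
      then show "X \<in> snd ` carrier B" using r sq by force
    qed
  qed
  have ker: "f ` carrier C = {b \<in> carrier B. snd b = \<zero>\<^bsub>loc_module R S\<^esub>}"
  proof (intro equalityI subsetI)
    fix b assume "b \<in> f ` carrier C"
    then show "b \<in> {b \<in> carrier B. snd b = \<zero>\<^bsub>loc_module R S\<^esub>}"
      using mod_homD(1)[OF f] by (auto simp: f_def sq zero_loc_module)
  next
    fix b assume "b \<in> {b \<in> carrier B. snd b = \<zero>\<^bsub>loc_module R S\<^esub>}"
    then obtain c r where b: "c \<in> carrier C" "r \<in> carrier R" "b = q (c, r)" "frac r = frac \<zero>"
      by (auto simp: carr M_def sq zero_loc_module)
    then have r: "r \<ominus> \<zero> \<in> I" using frac_eq_iff by auto
    \<comment> \<open>As r lies in I, the pair (c, r) is equivalent to (c + h(r), 0), which comes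
      from C.\<close>
    then have "b = f (c \<oplus>\<^bsub>C\<^esub> h (r \<ominus> \<zero>))"
      unfolding f_def b(3) using b(1,2) h(1)[OF r] by (subst q_eq) auto
    then show "b \<in> f ` carrier C" using b h(1)[OF r] by auto
  qed
  obtain s where s: "mod_hom R (loc_module R S) B s"
    and gs: "\<And>X. X \<in> carrier (loc_module R S) \<Longrightarrow> snd (s X) = X"
    using ext[unfolded ext1_vanishes_def, rule_format, OF conjI[OF B conjI[OF f conjI[OF g
      conjI[OF inj conjI[OF surj ker]]]]]] by auto
  note sD = mod_homD[OF s]
  have 1: "frac \<one> \<in> carrier (loc_module R S)" by (auto simp: carrier_loc_module)
  obtain c r where cr: "c \<in> carrier C" "r \<in> carrier R" "s (frac \<one>) = q (c, r)"
    using sD(1)[OF 1] by (auto simp: carr M_def)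
  have "frac r = frac \<one>" using gs[OF 1] cr by (simp add: sq)
  then have r: "r \<ominus> \<one> \<in> I" using frac_eq_iff cr by auto
  \<comment> \<open>The value of the section at 1 is represented by a pair (c, r) with r - 1 in I;
    shifting by r - 1 normalises it to (d, 1). By linearity the section then sends the class of x to
    the class of (x d, x).\<close>
  define d where "d = c \<oplus>\<^bsub>C\<^esub> h (r \<ominus> \<one>)"
  have d: "d \<in> carrier C" using cr h(1)[OF r] by (simp add: d_def)
  have sd: "s (frac \<one>) = q (d, \<one>)"
    unfolding cr(3) using cr d r by (subst q_eq) (auto simp: d_def)
  have sx: "s (frac x) = q (x \<odot>\<^bsub>C\<^esub> d, x)" if "x \<in> carrier R" for x
  proof -
    have "s (frac x) = x \<odot>\<^bsub>B\<^esub> s (frac \<one>)"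
      using sD(3)[OF that 1] smult_loc_module[OF that, of \<one>] that by simp
    then show ?thesis
      unfolding sd using qD(3)[OF that, of "(d, \<one>)"] that d by (simp add: M_def)
  qed
  \<comment> \<open>For x in I the class of x is zero, so (x d, x) and (0, 0) are equivalent, which
    says x d + h(x) = 0. Hence -d is the multiplier sought.\<close>
  have "h x = x \<odot>\<^bsub>C\<^esub> (\<ominus>\<^bsub>C\<^esub> d)" if x: "x \<in> I" for x
  proof -
    have xc: "x \<in> carrier R" using x I_closed by auto
    have x0: "x \<ominus> \<zero> = x" using xc by algebra
    then have "frac x = frac \<zero>" using frac_eq_iff xc x by auto
    then have "q (x \<odot>\<^bsub>C\<^esub> d, x) = q (\<zero>\<^bsub>C\<^esub>, \<zero>)" using sx[OF xc] sx[of \<zero>] d by simp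
    then have "\<zero>\<^bsub>C\<^esub> = x \<odot>\<^bsub>C\<^esub> d \<oplus>\<^bsub>C\<^esub> h x" using q_eq[of "x \<odot>\<^bsub>C\<^esub> d" "\<zero>\<^bsub>C\<^esub>" x \<zero>] xc d x0 by simp
    then have "h x = \<ominus>\<^bsub>C\<^esub> (x \<odot>\<^bsub>C\<^esub> d)"
      using xc d h(1)[OF x] by (metis C.M.minus_equality C.M.a_comm C.smult_closed)
    then show ?thesis using xc d by (simp add: C.smult_r_minus)
  qed
  then show ?thesis using d by blast
qed

end

section \<open>The free module of countable rank\<close>

lemma free_nat_module_simps [simp]:
  "u \<in> carrier (free_nat_module R) \<longleftrightarrow> (\<forall>n. u n \<in> carrier R) \<and> finite {n. u n \<noteq> \<zero>\<^bsub>R\<^esub>}"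
  "\<zero>\<^bsub>free_nat_module R\<^esub> = (\<lambda>n. \<zero>\<^bsub>R\<^esub>)"
  "u \<oplus>\<^bsub>free_nat_module R\<^esub> v = (\<lambda>n. u n \<oplus>\<^bsub>R\<^esub> v n)"
  "r \<odot>\<^bsub>free_nat_module R\<^esub> u = (\<lambda>n. r \<otimes>\<^bsub>R\<^esub> u n)"
  by (simp_all add: free_nat_module_def)

lemma module_free_nat_module:
  assumes "cring R"
  shows "module R (free_nat_module R)"
proof -
  interpret cring R by fact
  have fin: "finite {n. f n \<noteq> \<zero>\<^bsub>R\<^esub>}"
    if "finite {n. u n \<noteq> \<zero>\<^bsub>R\<^esub>}" "finite {n. v n \<noteq> \<zero>\<^bsub>R\<^esub>}"
      "\<And>n. u n = \<zero>\<^bsub>R\<^esub> \<Longrightarrow> v n = \<zero>\<^bsub>R\<^esub> \<Longrightarrow> f n = \<zero>\<^bsub>R\<^esub>" for u v f :: "nat \<Rightarrow> 'a"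
    using that by (intro finite_subset[of "{n. f n \<noteq> \<zero>\<^bsub>R\<^esub>}"
      "{n. u n \<noteq> \<zero>\<^bsub>R\<^esub>} \<union> {n. v n \<noteq> \<zero>\<^bsub>R\<^esub>}"]) auto
  show ?thesis
  proof (rule moduleI[OF assms abelian_groupI])
    fix u v assume "u \<in> carrier (free_nat_module R)" "v \<in> carrier (free_nat_module R)"
    then show "u \<oplus>\<^bsub>free_nat_module R\<^esub> v \<in> carrier (free_nat_module R)"
      using fin[of u v] by simp
  next
    fix r u assume "r \<in> carrier R" "u \<in> carrier (free_nat_module R)"
    then show "r \<odot>\<^bsub>free_nat_module R\<^esub> u \<in> carrier (free_nat_module R)"
      using fin[of u u] by simp
  next
    fix u assume "u \<in> carrier (free_nat_module R)"
    then show "\<exists>v\<in>carrier (free_nat_module R). v \<oplus>\<^bsub>free_nat_module R\<^esub> u = \<zero>\<^bsub>free_nat_module R\<^esub>"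
      using fin[of u u "\<lambda>n. \<ominus>\<^bsub>R\<^esub> u n"]
      by (intro bexI[of _ "\<lambda>n. \<ominus>\<^bsub>R\<^esub> u n"]) (auto simp: l_neg)
  qed (auto simp: a_ac m_ac l_distr r_distr)
qed

lemma free_support_bound:
  assumes "u \<in> carrier (free_nat_module R)"
  obtains N where "\<And>m. m \<ge> N \<Longrightarrow> u m = \<zero>\<^bsub>R\<^esub>"
proof -
  obtain N where "\<forall>m\<in>{n. u n \<noteq> \<zero>\<^bsub>R\<^esub>}. m < N"
    using assms finite_nat_set_iff_bounded by auto
  then show ?thesis using that[of N] by force
qed

definition unit_vec :: "'a ring \<Rightarrow> nat \<Rightarrow> nat \<Rightarrow> 'a" where
  "unit_vec R n = (\<lambda>m. if m = n then \<one>\<^bsub>R\<^esub> else \<zero>\<^bsub>R\<^esub>)"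

locale regular_ring = cring R for R :: "'a ring" (structure) +
  assumes vnr: "von_neumann_regular R"
begin

sublocale free: regular_ring_module R "free_nat_module R"
  using module_free_nat_module[OF is_cring] vnr
  by (simp add: regular_ring_module_def regular_ring_module_axioms_def)

lemma unit_vec_closed: "unit_vec R n \<in> carrier (free_nat_module R)"
  by (auto simp: unit_vec_def)

lemma mod_hom_coordinate: "mod_hom R (free_nat_module R) (regular_module R) (\<lambda>u. u m)"
  by (rule mod_homI) auto

text \<open>A common support bound turns the infinitely many conditions \<open>u m = \<zero>\<close>
  for m > n into finitely many linear conditions on P.\<close>

lemma fin_gen_free_support:
  assumes "fin_gen R (free_nat_module R) P"
  shows "\<exists>N. \<forall>u\<in>P. \<forall>m\<ge>N. u m = \<zero>"
  using assms
proof induction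
  case (extend P k)
  obtain N where N: "\<forall>u\<in>P. \<forall>m\<ge>N. u m = \<zero>" using extend(3) by auto
  obtain N' where N': "\<And>m. m \<ge> N' \<Longrightarrow> k m = \<zero>" using free_support_bound[OF extend(2)] by auto
  show ?case
    by (rule exI[of _ "max N N'"]) (use N N' in auto)
qed auto

lemma fin_gen_free_vanishing:
  assumes "finite A" "fin_gen R (free_nat_module R) P"
  shows "fin_gen R (free_nat_module R) {u \<in> P. \<forall>m\<in>A. u m = \<zero>}"
  using assms(1)
proof induction
  case empty
  then show ?case using assms(2) by simp
next
  case (insert a A)
  have "{u \<in> P. \<forall>m\<in>insert a A. u m = \<zero>} = {u \<in> {u \<in> P. \<forall>m\<in>A. u m = \<zero>}. u a = \<zero>}" by auto
  then show ?case using free.fin_gen_form_kernel[OF mod_hom_coordinate insert(3)] by simp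
qed

text \<open>The intersection Q of P with R^{n+1} is finitely generated, so the n-th coordinate form
  on Q takes an idempotent value generating the ideal of leading coefficients.\<close>

lemma fin_gen_leading_idempotent:
  assumes P: "fin_gen R (free_nat_module R) P"
  shows "\<exists>v\<in>P. (\<forall>m>n. v m = \<zero>) \<and> (\<forall>u\<in>P. (\<forall>m>n. u m = \<zero>) \<longrightarrow> u n \<otimes> v n = u n)"
proof -
  obtain N where N: "\<forall>u\<in>P. \<forall>m\<ge>N. u m = \<zero>" using fin_gen_free_support[OF P] by auto
  \<comment> \<open>Only the coordinates strictly between n and N need to be killed; from N on all
    elements of P vanish anyway.\<close>
  define Q where "Q = {u \<in> P. \<forall>m\<in>{n<..<N}. u m = \<zero>}"
  have Q: "u \<in> Q \<longleftrightarrow> u \<in> P \<and> (\<forall>m>n. u m = \<zero>)" for u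
    using N unfolding Q_def by (auto simp: not_less)
  have "fin_gen R (free_nat_module R) Q"
    unfolding Q_def by (rule fin_gen_free_vanishing[OF _ P]) auto
  from free.fin_gen_form_idempotent[OF mod_hom_coordinate this] show ?thesis
    by (metis Q)
qed

end

section \<open>Exhausting a countably generated submodule\<close>

text \<open>The submodule spanned by the first j generators. The successor clause has the shape of
  \<open>fin_gen.extend\<close>, so each stage is finitely generated by construction.\<close>

primrec gen_chain :: "'a ring \<Rightarrow> ('a,'b) module \<Rightarrow> (nat \<Rightarrow> 'b) \<Rightarrow> nat \<Rightarrow> 'b set" where
  "gen_chain R M k 0 = {\<zero>\<^bsub>M\<^esub>}"
| "gen_chain R M k (Suc j) = {p \<oplus>\<^bsub>M\<^esub> r \<odot>\<^bsub>M\<^esub> k j | p r. p \<in> gen_chain R M k j \<and> r \<in> carrier R}"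

context
  fixes R :: "'a ring" and M :: "('a,'b) module" and k :: "nat \<Rightarrow> 'b"
  assumes module: "module R M" and k: "\<And>j. k j \<in> carrier M"
begin

interpretation module R M by (rule module)

lemma fin_gen_gen_chain: "fin_gen R M (gen_chain R M k j)"
proof (induction j)
  case (Suc j)
  show ?case using fin_gen.extend[OF Suc k] by simp
qed (simp add: fin_gen.zero)

lemma gen_chain_closed: "p \<in> gen_chain R M k j \<Longrightarrow> p \<in> carrier M"
  using submoduleE(1)[OF fin_gen_submodule[OF fin_gen_gen_chain[of j]]] by auto

lemma gen_chain_Suc_mono: "gen_chain R M k j \<subseteq> gen_chain R M k (Suc j)"
proof
  fix p assume p: "p \<in> gen_chain R M k j"
  then have "p = p \<oplus>\<^bsub>M\<^esub> \<zero>\<^bsub>R\<^esub> \<odot>\<^bsub>M\<^esub> k j" using gen_chain_closed k by simp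
  then show "p \<in> gen_chain R M k (Suc j)" using p by auto
qed

lemma gen_chain_mono: "i \<le> j \<Longrightarrow> gen_chain R M k i \<subseteq> gen_chain R M k j"
  by (rule lift_Suc_mono_le[where f = "gen_chain R M k", OF gen_chain_Suc_mono])

lemma submodule_UN_gen_chain: "submodule (\<Union>j. gen_chain R M k j) R M"
proof (rule submoduleI)
  note sub = submoduleE[OF fin_gen_submodule[OF fin_gen_gen_chain]]
  show "(\<Union>j. gen_chain R M k j) \<subseteq> carrier M" using gen_chain_closed by auto
  show "\<zero>\<^bsub>M\<^esub> \<in> (\<Union>j. gen_chain R M k j)" by (rule UN_I[of 0]) auto
  show "\<ominus>\<^bsub>M\<^esub> a \<in> (\<Union>j. gen_chain R M k j)" if "a \<in> (\<Union>j. gen_chain R M k j)" for a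
    using that sub(3) by blast
  show "r \<odot>\<^bsub>M\<^esub> a \<in> (\<Union>j. gen_chain R M k j)"
    if "r \<in> carrier R" "a \<in> (\<Union>j. gen_chain R M k j)" for a r
    using that sub(4) by blast
  show "a \<oplus>\<^bsub>M\<^esub> b \<in> (\<Union>j. gen_chain R M k j)"
    if ab: "a \<in> (\<Union>j. gen_chain R M k j)" "b \<in> (\<Union>j. gen_chain R M k j)" for a b
  proof -
    obtain i j where "a \<in> gen_chain R M k i" "b \<in> gen_chain R M k j" using ab by auto
    then have "a \<in> gen_chain R M k (max i j)" "b \<in> gen_chain R M k (max i j)"
      using gen_chain_mono[of i "max i j"] gen_chain_mono[of j "max i j"] by auto
    then show ?thesis using sub(5) by blast
  qed
qed

lemma submodule_gen_range: "submodule_gen R M (range k) = (\<Union>j. gen_chain R M k j)"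
proof
  have "k j \<in> gen_chain R M k (Suc j)" for j
  proof -
    have "k j = \<zero>\<^bsub>M\<^esub> \<oplus>\<^bsub>M\<^esub> \<one>\<^bsub>R\<^esub> \<odot>\<^bsub>M\<^esub> k j" using k by simp
    moreover have "\<zero>\<^bsub>M\<^esub> \<in> gen_chain R M k j"
      by (rule submodule_zero_closed[OF fin_gen_submodule[OF fin_gen_gen_chain]])
    ultimately show ?thesis by (auto intro!: exI[of _ "\<zero>\<^bsub>M\<^esub>"] exI[of _ "\<one>\<^bsub>R\<^esub>"])
  qed
  then have "range k \<subseteq> (\<Union>j. gen_chain R M k j)" by blast
  then show "submodule_gen R M (range k) \<subseteq> (\<Union>j. gen_chain R M k j)"
    unfolding submodule_gen_def using submodule_UN_gen_chain by blast
  have "gen_chain R M k j \<subseteq> N" if N: "submodule N R M" "range k \<subseteq> N" for N j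
  proof (induction j)
    case 0
    then show ?case using submodule_zero_closed[OF N(1)] by simp
  next
    case (Suc j)
    then show ?case using N(2) by (auto intro!: submoduleE(4,5)[OF N(1)])
  qed
  then show "(\<Union>j. gen_chain R M k j) \<subseteq> submodule_gen R M (range k)"
    unfolding submodule_gen_def by blast
qed

end

text \<open>A countable generating set may be empty; with zero inserted it is the range of a
  sequence and \<open>gen_chain\<close> applies.\<close>

lemma submodule_gen_insert_zero:
  fixes R :: "'a ring" and M :: "('a,'b) module"
  assumes "module R M"
  shows "submodule_gen R M (insert \<zero>\<^bsub>M\<^esub> K) = submodule_gen R M K"
  using module.submodule_zero_closed[OF assms] unfolding submodule_gen_def by blast

section \<open>Ideals of leading coefficients\<close>

context regular_ring
begin

text \<open>The submodule K is exhausted by finitely generated P_j, and each P_j supplies an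
  idempotent e_j. These are chosen independently, but are compatible because the vector that yields
  e_i also lies in P_j for i \<le> j.\<close>

lemma leading_ideal_localization:
  assumes "countable G" "G \<subseteq> carrier (free_nat_module R)"
  defines "K \<equiv> submodule_gen R (free_nat_module R) G"
  shows "\<exists>S. countable S \<and> surjective_localization R {u n | u. u \<in> K \<and> (\<forall>m>n. u m = \<zero>)} S"
proof -
  let ?F = "free_nat_module R"
  define I where "I = {u n | u. u \<in> K \<and> (\<forall>m>n. u m = \<zero>)}"
  obtain k :: "nat \<Rightarrow> nat \<Rightarrow> 'a" where k: "range k = insert \<zero>\<^bsub>?F\<^esub> G"
    using range_from_nat_into[of "insert \<zero>\<^bsub>?F\<^esub> G"] assms(1) by blast
  have kc: "k j \<in> carrier ?F" for j
  proof -
    have "k j \<in> insert \<zero>\<^bsub>?F\<^esub> G" using k by blast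
    then show ?thesis using assms(2) free.M.zero_closed by (metis insertE subsetD)
  qed
  note free_mod = free.module_axioms
  define P where "P = gen_chain R ?F k"
  have K: "K = (\<Union>j. P j)"
    unfolding K_def P_def submodule_gen_range[OF free_mod kc, symmetric] k
    using submodule_gen_insert_zero[OF free_mod] by simp
  have Ksub: "submodule K R ?F"
    unfolding K P_def by (rule submodule_UN_gen_chain[OF free_mod kc])
  note Kc = free.submoduleE[OF Ksub]
  have KR: "u i \<in> carrier R" if "u \<in> K" for u i using that Kc(1) by auto
  have "\<forall>j. \<exists>v\<in>P j. (\<forall>m>n. v m = \<zero>) \<and> (\<forall>u\<in>P j. (\<forall>m>n. u m = \<zero>) \<longrightarrow> u n \<otimes> v n = u n)"
    unfolding P_def by (intro allI fin_gen_leading_idempotent fin_gen_gen_chain[OF free_mod kc])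
  then obtain v where v: "\<And>j. v j \<in> P j" "\<And>j m. m > n \<Longrightarrow> v j m = \<zero>"
    "\<And>j u. u \<in> P j \<Longrightarrow> (\<And>m. m > n \<Longrightarrow> u m = \<zero>) \<Longrightarrow> u n \<otimes> v j n = u n" by metis
  define e where "e j = v j n" for j
  have vK: "v j \<in> K" for j using v(1) K by auto
  have ec: "e j \<in> carrier R" for j using KR[OF vK] by (simp add: e_def)
  have eI: "e j \<in> I" for j unfolding I_def e_def using vK v(2) by blast
  have ee: "e i \<otimes> e j = e i" if "i \<le> j" for i j
  proof -
    have "v i \<in> P j" using v(1)[of i] gen_chain_mono[where k = k, OF free_mod kc that] by (auto simp: P_def)
    then show ?thesis using v(2,3) by (simp add: e_def)
  qed
  \<comment> \<open>\<open>P 0\<close> is the zero module, so the first idempotent is 0; this is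
    what puts 1 into S.\<close>
  have e0: "e 0 = \<zero>" using v(1)[of 0] by (simp add: e_def P_def)
  define S where "S = range (\<lambda>j. \<one> \<ominus> e j)"
  \<comment> \<open>From e_i e_j = e_i: the complementary idempotents decrease, a product is the one
    with the larger index, and so S is closed under multiplication.\<close>
  have prod: "(\<one> \<ominus> e i) \<otimes> (\<one> \<ominus> e j) = \<one> \<ominus> e j" if "i \<le> j" for i j
  proof -
    have "(\<one> \<ominus> e i) \<otimes> (\<one> \<ominus> e j) = \<one> \<ominus> e i \<ominus> e j \<oplus> e i \<otimes> e j"
      using ec[of i] ec[of j] by algebra
    also have "\<dots> = \<one> \<ominus> e j" unfolding ee[OF that] using ec[of i] ec[of j] by algebra
    finally show ?thesis .
  qed
  have "surjective_localization R I S"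
  proof (intro surjective_localization.intro surjective_localization_axioms.intro is_cring)
    show "mult_subset R S"
      unfolding mult_subset_def
    proof (intro conjI ballI)
      show "S \<subseteq> carrier R" using ec by (auto simp: S_def)
      have "\<one> = \<one> \<ominus> e 0" unfolding e0 by algebra
      then show "\<one> \<in> S" unfolding S_def by blast
      fix s t assume "s \<in> S" "t \<in> S"
      then obtain i j where s: "s = \<one> \<ominus> e i" "t = \<one> \<ominus> e j" by (auto simp: S_def)
      show "s \<otimes> t \<in> S"
      proof (cases "i \<le> j")
        case True
        then show ?thesis unfolding s prod[OF True] by (simp add: S_def)
      next
        case False
        then have "s \<otimes> t = \<one> \<ominus> e i"
          unfolding s using prod[of j i] ec[of i] ec[of j]
            m_comm[of "\<one> \<ominus> e i" "\<one> \<ominus> e j"] by simp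
        then show ?thesis by (simp add: S_def)
      qed
    qed
    show "\<one> \<ominus> s \<in> I" if s: "s \<in> S" for s
    proof -
      obtain j where "s = \<one> \<ominus> e j" using s by (auto simp: S_def)
      moreover have "\<one> \<ominus> (\<one> \<ominus> e j) = e j" using ec[of j] by algebra
      ultimately show ?thesis using eI by simp
    qed
    show "\<exists>t\<in>S. t \<otimes> x = \<zero>" if x: "x \<in> I" for x
    proof -
      obtain u where u: "u \<in> K" "\<And>m. m > n \<Longrightarrow> u m = \<zero>" "x = u n" using x by (auto simp: I_def)
      obtain j where j: "u \<in> P j" using u K by auto
      have xc: "x \<in> carrier R" using KR u by auto
      have xe: "x \<otimes> e j = x" using v(3)[OF j u(2)] u(3) by (simp add: e_def)
      have "(\<one> \<ominus> e j) \<otimes> x = x \<ominus> x \<otimes> e j" using xc ec[of j] by algebra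
      also have "\<dots> = \<zero>" unfolding xe using xc by algebra
      finally show ?thesis by (auto simp: S_def)
    qed
    have I_add: "x \<oplus> y \<in> I" if xy: "x \<in> I" "y \<in> I" for x y
    proof -
      obtain u w where u: "u \<in> K" "\<And>m. m > n \<Longrightarrow> u m = \<zero>" "x = u n"
        "w \<in> K" "\<And>m. m > n \<Longrightarrow> w m = \<zero>" "y = w n" using xy by (auto simp: I_def)
      have "(\<lambda>i. u i \<oplus> w i) \<in> K" using Kc(5)[OF u(1,4)] by simp
      then show ?thesis unfolding I_def using u by (auto intro!: exI[of _ "\<lambda>i. u i \<oplus> w i"])
    qed
    have I_mult: "r \<otimes> x \<in> I" if rx: "r \<in> carrier R" "x \<in> I" for r x
    proof -
      obtain u where u: "u \<in> K" "\<And>m. m > n \<Longrightarrow> u m = \<zero>" "x = u n" using rx by (auto simp: I_def)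
      have "(\<lambda>i. r \<otimes> u i) \<in> K" using Kc(4)[OF rx(1) u(1)] by simp
      then show ?thesis unfolding I_def using u rx by (auto intro!: exI[of _ "\<lambda>i. r \<otimes> u i"])
    qed
    have IR: "I \<subseteq> carrier R" using KR by (auto simp: I_def)
    show "ideal I R"
    proof (rule idealI[OF ring_axioms])
      show "subgroup I (add_monoid R)"
      proof (rule add.subgroupI)
        show "I \<subseteq> carrier R" by (rule IR)
        show "I \<noteq> {}" using eI by auto
        show "\<ominus> x \<in> I" if "x \<in> I" for x
        proof -
          have "\<ominus> x = (\<ominus> \<one>) \<otimes> x" using that IR by (auto simp: l_minus)
          then show ?thesis using I_mult[of "\<ominus> \<one>" x] that by simp
        qed
      qed (rule I_add)
      show "x \<otimes> a \<in> I" if "a \<in> I" "x \<in> carrier R" for a x using I_mult that by auto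
      show "a \<otimes> x \<in> I" if "a \<in> I" "x \<in> carrier R" for a x
        using I_mult[OF that(2,1)] that IR m_comm[of a x] by auto
    qed
  qed
  moreover have "countable S" by (simp add: S_def)
  ultimately show ?thesis unfolding I_def by blast
qed

end

section \<open>Splitting extensions of countably presented modules\<close>

text \<open>The linear combination of the first n terms. The recursion makes it visible that only
  \<open>b i\<close> with i < n matter, which allows \<open>b n\<close> to be chosen afterwards, and
  it splits off the last summand, where the new lift enters.\<close>

primrec psum :: "('a,'b) module \<Rightarrow> (nat \<Rightarrow> 'b) \<Rightarrow> nat \<Rightarrow> (nat \<Rightarrow> 'a) \<Rightarrow> 'b" where
  "psum M b 0 u = \<zero>\<^bsub>M\<^esub>"
| "psum M b (Suc n) u = psum M b n u \<oplus>\<^bsub>M\<^esub> u n \<odot>\<^bsub>M\<^esub> b n"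

lemma psum_cong: "(\<And>i. i < n \<Longrightarrow> b i = b' i) \<Longrightarrow> (\<And>i. i < n \<Longrightarrow> u i = u' i) \<Longrightarrow>
    psum M b n u = psum M b' n u'"
  by (induction n) auto

context
  fixes R :: "'a ring" and M :: "('a,'b) module"
  assumes module: "module R M"
begin

interpretation module R M by (rule module)

lemma psum_closed:
  "(\<And>i. i < n \<Longrightarrow> b i \<in> carrier M) \<Longrightarrow> u \<in> carrier (free_nat_module R) \<Longrightarrow> psum M b n u \<in> carrier M"
  by (induction n) auto

lemma psum_add:
  assumes "\<And>i. i < n \<Longrightarrow> b i \<in> carrier M"
    and "u \<in> carrier (free_nat_module R)" "v \<in> carrier (free_nat_module R)"
  shows "psum M b n (u \<oplus>\<^bsub>free_nat_module R\<^esub> v) = psum M b n u \<oplus>\<^bsub>M\<^esub> psum M b n v"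
  using assms
proof (induction n)
  case (Suc n)
  then show ?case
    using psum_closed[of n b u] psum_closed[of n b v]
    by (simp add: smult_l_distr M.a_ac)
qed simp

lemma psum_smult:
  assumes "\<And>i. i < n \<Longrightarrow> b i \<in> carrier M"
    and "r \<in> carrier R" "u \<in> carrier (free_nat_module R)"
  shows "psum M b n (r \<odot>\<^bsub>free_nat_module R\<^esub> u) = r \<odot>\<^bsub>M\<^esub> psum M b n u"
  using assms
proof (induction n)
  case (Suc n)
  then show ?case
    using psum_closed[of n b u] by (simp add: smult_r_distr smult_assoc1)
qed simp

lemma psum_stable:
  assumes "n \<le> m" "\<And>i. b i \<in> carrier M" "\<And>i. u i \<in> carrier R" "\<And>i. i \<ge> n \<Longrightarrow> u i = \<zero>\<^bsub>R\<^esub>"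
  shows "psum M b m u = psum M b n u"
  using assms(1)
proof (induction m rule: dec_induct)
  case (step m)
  have "psum M b m u \<in> carrier M" by (induction m) (use assms in auto)
  then show ?case using step assms by simp
qed simp

end

lemma (in regular_ring) hom_eq_psum:
  assumes "module R N" "mod_hom R (free_nat_module R) N \<pi>"
    and "\<And>m. m \<ge> n \<Longrightarrow> u m = \<zero>" "u \<in> carrier (free_nat_module R)"
  shows "\<pi> u = psum N (\<lambda>i. \<pi> (unit_vec R i)) n u"
  using assms(3,4)
proof (induction n arbitrary: u)
  case 0
  then have "u = \<zero>\<^bsub>free_nat_module R\<^esub>" by auto
  then show ?case using mod_hom_zero[OF free.module_axioms assms(1,2)] by simp
next
  case (Suc n)
  define v where "v = u(n := \<zero>)"
  have "{i. v i \<noteq> \<zero>} \<subseteq> {i. u i \<noteq> \<zero>}" by (auto simp: v_def)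
  then have v: "v \<in> carrier (free_nat_module R)"
    using Suc.prems(2) by (auto simp: v_def intro: finite_subset)
  have un: "u n \<in> carrier R" using Suc.prems(2) by auto
  have "\<pi> v = psum N (\<lambda>i. \<pi> (unit_vec R i)) n v"
    using Suc.prems(1) v by (intro Suc.IH) (auto simp: v_def)
  also have "\<dots> = psum N (\<lambda>i. \<pi> (unit_vec R i)) n u" by (intro psum_cong) (auto simp: v_def)
  finally have \<pi>v: "\<pi> v = psum N (\<lambda>i. \<pi> (unit_vec R i)) n u" .
  have "u = v \<oplus>\<^bsub>free_nat_module R\<^esub> u n \<odot>\<^bsub>free_nat_module R\<^esub> unit_vec R n"
    using Suc.prems(2) by (auto simp: v_def unit_vec_def)
  moreover have "\<pi> (v \<oplus>\<^bsub>free_nat_module R\<^esub> u n \<odot>\<^bsub>free_nat_module R\<^esub> unit_vec R n)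
      = \<pi> v \<oplus>\<^bsub>N\<^esub> u n \<odot>\<^bsub>N\<^esub> \<pi> (unit_vec R n)"
    using mod_homD(2,3)[OF assms(2)] v un unit_vec_closed free.smult_closed by metis
  ultimately have "\<pi> u = \<pi> v \<oplus>\<^bsub>N\<^esub> u n \<odot>\<^bsub>N\<^esub> \<pi> (unit_vec R n)" by simp
  then show ?case using \<pi>v by simp
qed

text \<open>The lifts $b_0, b_1, \dots$ of the generators are chosen one after the other: an arbitrary
  lift of the $n$-th generator violates the relations supported on $\{0,\dots,n\}$ by a linear map
  from the ideal of their $n$-th coefficients to $C$, and this map is multiplication by an element
  of $C$ that corrects the lift.\<close>
lemma (in regular_ring) correct_lift:
  fixes C :: "('a,'c) module" and B :: "('a,'b) module" and F :: "('a,'f) module"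
  assumes F: "module R F" and C: "module R C" and B: "module R B" and ac: "almost_cotorsion R C"
    and f: "mod_hom R C B f" and g: "mod_hom R B F g" and inj: "inj_on f (carrier C)"
    and surj: "g ` carrier B = carrier F"
    and ker: "f ` carrier C = {b \<in> carrier B. g b = \<zero>\<^bsub>F\<^esub>}"
    and \<pi>: "mod_hom R (free_nat_module R) F \<pi>"
    and G: "countable G" "G \<subseteq> carrier (free_nat_module R)"
    and K: "K = {u \<in> carrier (free_nat_module R). \<pi> u = \<zero>\<^bsub>F\<^esub>}"
      "K = submodule_gen R (free_nat_module R) G"
    and b: "\<And>i. i < n \<Longrightarrow> b i \<in> carrier B" "\<And>i. i < n \<Longrightarrow> g (b i) = \<pi> (unit_vec R i)"
    and b0: "\<And>u. u \<in> K \<Longrightarrow> (\<And>m. m \<ge> n \<Longrightarrow> u m = \<zero>) \<Longrightarrow> psum B b n u = \<zero>\<^bsub>B\<^esub>"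
  shows "\<exists>x\<in>carrier B. g x = \<pi> (unit_vec R n) \<and>
    (\<forall>u\<in>K. (\<forall>m\<ge>Suc n. u m = \<zero>) \<longrightarrow> psum B b n u \<oplus>\<^bsub>B\<^esub> u n \<odot>\<^bsub>B\<^esub> x = \<zero>\<^bsub>B\<^esub>)"
proof -
  let ?F = "free_nat_module R"
  interpret C: module R C by fact
  interpret B: module R B by fact
  interpret F: module R F by fact
  note \<pi>D = mod_homD[OF \<pi>] and gD = mod_homD[OF g] and fD = mod_homD[OF f]
  obtain y where y: "y \<in> carrier B" "g y = \<pi> (unit_vec R n)"
    using surj \<pi>D(1)[OF unit_vec_closed] by (metis imageE)
  define I where "I = {u n | u. u \<in> K \<and> (\<forall>m>n. u m = \<zero>)}"
  obtain S where S: "countable S" "surjective_localization R I S"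
    using leading_ideal_localization[OF G] unfolding I_def K(2) by blast
  interpret S: surjective_localization R I S by (rule S)
  have ext: "ext1_vanishes R (loc_module R S) C"
    using ac S(1) S.S by (simp add: almost_cotorsion_def)
  \<comment> \<open>The obstruction: the value of the combination when the arbitrary lift y is used
    for the n-th generator. L collects the relations on which it has to vanish after
    correction.\<close>
  define D where "D u = psum B b n u \<oplus>\<^bsub>B\<^esub> u n \<odot>\<^bsub>B\<^esub> y" for u
  define L where "L = {u \<in> K. \<forall>m>n. u m = \<zero>}"
  have Kc: "u \<in> carrier ?F" if "u \<in> K" for u using that K(1) by auto
  have KR: "u i \<in> carrier R" if "u \<in> K" for u i using Kc[OF that] by auto
  have K_add: "u \<oplus>\<^bsub>?F\<^esub> v \<in> K" if "u \<in> K" "v \<in> K" for u v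
    using that \<pi>D(2)[of u v] free.M.a_closed[of u v] F.M.zero_closed unfolding K(1)
    by (simp del: free_nat_module_simps)
  have K_smult: "r \<odot>\<^bsub>?F\<^esub> u \<in> K" if "r \<in> carrier R" "u \<in> K" for r u
    using that \<pi>D(3)[of r u] free.smult_closed[of r u] unfolding K(1)
    by (simp del: free_nat_module_simps)
  have Lc: "u \<in> carrier ?F" "u \<in> K" "u n \<in> I" if "u \<in> L" for u
    using that Kc unfolding L_def I_def by blast+
  have L_add: "u \<oplus>\<^bsub>?F\<^esub> v \<in> L" if "u \<in> L" "v \<in> L" for u v
    using that K_add[of u v] by (simp add: L_def)
  have L_smult: "r \<odot>\<^bsub>?F\<^esub> u \<in> L" if "r \<in> carrier R" "u \<in> L" for r u
    using that K_smult[of r u] by (simp add: L_def)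
  have D_closed: "D u \<in> carrier B" if "u \<in> L" for u
    using psum_closed[OF B b(1) Lc(1)[OF that]] y KR[OF Lc(2)[OF that]] by (simp add: D_def)
  have D_add: "D (u \<oplus>\<^bsub>?F\<^esub> v) = D u \<oplus>\<^bsub>B\<^esub> D v" if "u \<in> L" "v \<in> L" for u v
    using psum_add[OF B b(1) Lc(1)[OF that(1)] Lc(1)[OF that(2)]]
      psum_closed[OF B b(1) Lc(1)[OF that(1)]] psum_closed[OF B b(1) Lc(1)[OF that(2)]]
      KR[OF Lc(2)[OF that(1)]] KR[OF Lc(2)[OF that(2)]] y
    by (simp add: D_def B.smult_l_distr B.M.a_ac)
  have D_smult: "D (r \<odot>\<^bsub>?F\<^esub> u) = r \<odot>\<^bsub>B\<^esub> D u" if "r \<in> carrier R" "u \<in> L" for r u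
    using psum_smult[OF B b(1) that(1) Lc(1)[OF that(2)]]
      psum_closed[OF B b(1) Lc(1)[OF that(2)]] KR[OF Lc(2)[OF that(2)]] y that(1)
    by (simp add: D_def B.smult_r_distr B.smult_assoc1)
  have g_psum: "g (psum B b m u) = psum F (\<lambda>i. \<pi> (unit_vec R i)) m u"
    if "m \<le> n" "u \<in> carrier ?F" for m u
    using that(1)
  proof (induction m)
    case 0
    then show ?case using mod_hom_zero[OF B F g] by simp
  next
    case (Suc m)
    have bm: "b m \<in> carrier B" "u m \<in> carrier R" using Suc b that by auto
    have "psum B b m u \<in> carrier B" using Suc b that by (intro psum_closed[OF B]) auto
    then show ?case using Suc bm b(2)[of m] by (simp add: gD)
  qed
  \<comment> \<open>Applying g to D u gives \<pi> u, since all the lifts are correct modulo f(C);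
    this vanishes on relations, so D takes its values in f(C).\<close>
  have gD0: "g (D u) = \<zero>\<^bsub>F\<^esub>" if "u \<in> L" for u
  proof -
    have "g (D u) = psum F (\<lambda>i. \<pi> (unit_vec R i)) (Suc n) u"
      using psum_closed[OF B b(1) Lc(1)[OF that]] y KR[OF Lc(2)[OF that]] g_psum Lc(1)[OF that]
      by (simp add: D_def gD)
    also have "\<dots> = \<pi> u"
      using that by (intro hom_eq_psum[OF F \<pi>, symmetric] Lc(1)) (auto simp: L_def)
    also have "\<dots> = \<zero>\<^bsub>F\<^esub>" using Lc(2)[OF that] K(1) by auto
    finally show ?thesis .
  qed
  \<comment> \<open>The induction hypothesis \<open>b0\<close> enters here: a relation with zero
    n-th coefficient is supported below n, where it is already respected. Hence D u depends only on
    \<open>u n\<close>.\<close>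
  have D_zero: "D u = \<zero>\<^bsub>B\<^esub>" if "u \<in> L" "u n = \<zero>" for u
  proof -
    have "u m = \<zero>" if "m \<ge> n" for m using \<open>u \<in> L\<close> \<open>u n = \<zero>\<close> that by (cases "m = n") (auto simp: L_def)
    then have "psum B b n u = \<zero>\<^bsub>B\<^esub>" using b0[OF Lc(2)[OF that(1)]] by simp
    then show ?thesis using that y by (simp add: D_def)
  qed
  have D_eq: "D u = D v" if "u \<in> L" "v \<in> L" "u n = v n" for u v
  proof -
    define w where "w = u \<oplus>\<^bsub>?F\<^esub> (\<ominus> \<one>) \<odot>\<^bsub>?F\<^esub> v"
    have vn: "v n \<in> carrier R" using KR Lc that by auto
    have "w n = \<zero>" unfolding w_def using that(3) vn by (simp add: l_minus r_neg)
    moreover have "w \<in> L" unfolding w_def using that by (intro L_add L_smult) auto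
    ultimately have "D w = \<zero>\<^bsub>B\<^esub>" using D_zero by auto
    moreover have "D w = D u \<oplus>\<^bsub>B\<^esub> (\<ominus> \<one>) \<odot>\<^bsub>B\<^esub> D v"
      unfolding w_def using that D_add[OF _ L_smult] D_smult by simp
    ultimately have "D u \<oplus>\<^bsub>B\<^esub> \<ominus>\<^bsub>B\<^esub> D v = \<zero>\<^bsub>B\<^esub>"
      using D_closed[OF that(2)] by (simp add: B.smult_l_minus)
    then show ?thesis
      using D_closed[OF that(1)] D_closed[OF that(2)] B.M.minus_equality B.M.minus_minus
      by (metis B.M.a_inv_closed)
  qed
  \<comment> \<open>D transported to a map from I to C; by the preceding step the choice of the
    relation u with n-th coefficient r is immaterial.\<close>
  define h where "h r = inv_into (carrier C) f (D (SOME u. u \<in> L \<and> u n = r))" for r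
  have fh: "h (u n) \<in> carrier C" "f (h (u n)) = D u" if u: "u \<in> L" for u
  proof -
    define v where "v = (SOME v. v \<in> L \<and> v n = u n)"
    have "v \<in> L \<and> v n = u n" unfolding v_def
      by (rule someI[where x = u]) (simp add: u)
    then have v: "D v = D u" using D_eq[of v u] u by auto
    have Dk: "D u \<in> f ` carrier C" unfolding ker using D_closed gD0 u by auto
    have h: "h (u n) = inv_into (carrier C) f (D u)" unfolding h_def v_def[symmetric] v ..
    show "h (u n) \<in> carrier C" "f (h (u n)) = D u" unfolding h
      using Dk by (auto intro: inv_into_into f_inv_into_f)
  qed
  have IL: "\<exists>u\<in>L. x = u n" if "x \<in> I" for x using that unfolding I_def L_def by blast
  have inj': "x = x'" if "f x = f x'" "x \<in> carrier C" "x' \<in> carrier C" for x x'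
    using inj that by (auto dest: inj_onD)
  have "\<exists>c\<in>carrier C. \<forall>x\<in>I. h x = x \<odot>\<^bsub>C\<^esub> c"
  proof (rule S.extend_from_ideal[OF C ext])
    fix x assume "x \<in> I"
    then obtain u where u: "u \<in> L" "x = u n" using IL by auto
    then show "h x \<in> carrier C" using fh by auto
    fix r assume r: "r \<in> carrier R"
    have "f (h ((r \<odot>\<^bsub>?F\<^esub> u) n)) = f (r \<odot>\<^bsub>C\<^esub> h (u n))"
      using fh[OF L_smult[OF r u(1)]] fh[OF u(1)] D_smult[OF r u(1)] r
      by (simp add: fD del: free_nat_module_simps)
    then have "h ((r \<odot>\<^bsub>?F\<^esub> u) n) = r \<odot>\<^bsub>C\<^esub> h (u n)"
      using fh(1)[OF L_smult[OF r u(1)]] fh(1)[OF u(1)] r by (intro inj') auto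
    then show "h (r \<otimes> x) = r \<odot>\<^bsub>C\<^esub> h x" using u by simp
  next
    fix x z assume "x \<in> I" "z \<in> I"
    then obtain u v where u: "u \<in> L" "x = u n" "v \<in> L" "z = v n" using IL by meson
    have "f (h ((u \<oplus>\<^bsub>?F\<^esub> v) n)) = f (h (u n) \<oplus>\<^bsub>C\<^esub> h (v n))"
      using fh[OF L_add[OF u(1,3)]] fh[OF u(1)] fh[OF u(3)] D_add[OF u(1,3)]
      by (simp add: fD del: free_nat_module_simps)
    then have "h ((u \<oplus>\<^bsub>?F\<^esub> v) n) = h (u n) \<oplus>\<^bsub>C\<^esub> h (v n)"
      using fh(1)[OF L_add[OF u(1,3)]] fh(1)[OF u(1)] fh(1)[OF u(3)] by (intro inj') auto
    then show "h (x \<oplus> z) = h x \<oplus>\<^bsub>C\<^esub> h z" using u by simp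
  qed
  then obtain c where c: "c \<in> carrier C" "\<And>x. x \<in> I \<Longrightarrow> h x = x \<odot>\<^bsub>C\<^esub> c" by auto
  \<comment> \<open>On L, D u = f(h(u n)) = u n \<odot> f c, so replacing y by y - f c cancels the
    obstruction, while g does not see f c.\<close>
  define x where "x = y \<oplus>\<^bsub>B\<^esub> \<ominus>\<^bsub>B\<^esub> f c"
  have fc: "f c \<in> carrier B" "g (f c) = \<zero>\<^bsub>F\<^esub>" using c(1) ker by blast+
  have xB: "x \<in> carrier B" using y fc by (simp add: x_def)
  moreover have "g x = \<pi> (unit_vec R n)"
    using y fc mod_hom_minus[OF B F g fc(1)] \<pi>D(1)[OF unit_vec_closed] by (simp add: x_def gD)
  moreover have "psum B b n u \<oplus>\<^bsub>B\<^esub> u n \<odot>\<^bsub>B\<^esub> x = \<zero>\<^bsub>B\<^esub>"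
    if "u \<in> K" "\<forall>m\<ge>Suc n. u m = \<zero>" for u
  proof -
    have u: "u \<in> L" using that by (auto simp: L_def)
    have un: "u n \<in> carrier R" using KR that by auto
    have "D u = u n \<odot>\<^bsub>B\<^esub> f c"
      using fh(2)[OF u] c(2)[OF Lc(3)[OF u]] fD(3)[OF un c(1)] by simp
    moreover have "psum B b n u \<oplus>\<^bsub>B\<^esub> u n \<odot>\<^bsub>B\<^esub> x = D u \<oplus>\<^bsub>B\<^esub> \<ominus>\<^bsub>B\<^esub> (u n \<odot>\<^bsub>B\<^esub> f c)"
      using psum_closed[OF B b(1) Lc(1)[OF u]] un y fc
      by (simp add: D_def x_def B.smult_r_distr B.smult_r_minus B.M.a_ac)
    ultimately show ?thesis using un fc by (simp add: B.M.r_neg)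
  qed
  ultimately show ?thesis by blast
qed

text \<open>The lifts from \<open>correct_lift\<close> define a map \<sigma> from the free module to
  B over F. Each relation has finite support and so is respected from some stage on; \<sigma> kills
  K and descends to the section.\<close>

lemma (in regular_ring) countably_presented_ext1_vanishes:
  fixes C :: "('a,'c) module" and F :: "('a,'f) module"
  assumes F: "module R F" and cp: "countably_presented R F"
    and C: "module R C" and ac: "almost_cotorsion R C"
  shows "ext1_vanishes R F C"
  unfolding ext1_vanishes_def
proof (intro allI impI, elim conjE)
  fix B :: "('a, 'c \<times> 'f) module" and f g
  assume B: "module R B" and f: "mod_hom R C B f" and g: "mod_hom R B F g"
    and inj: "inj_on f (carrier C)" and surj: "g ` carrier B = carrier F"
    and ker: "f ` carrier C = {b \<in> carrier B. g b = \<zero>\<^bsub>F\<^esub>}"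
  let ?F = "free_nat_module R"
  obtain \<pi> G where \<pi>: "mod_hom R ?F F \<pi>" and \<pi>s: "\<pi> ` carrier ?F = carrier F"
    and G: "countable G" "G \<subseteq> carrier ?F"
    and KG: "{u \<in> carrier ?F. \<pi> u = \<zero>\<^bsub>F\<^esub>} = submodule_gen R ?F G"
    using cp unfolding countably_presented_def by blast
  define K where "K = {u \<in> carrier ?F. \<pi> u = \<zero>\<^bsub>F\<^esub>}"
  interpret B: module R B by fact
  interpret F: module R F by fact
  note \<pi>D = mod_homD[OF \<pi>] and gD = mod_homD[OF g]
  \<comment> \<open>The candidate x is kept apart from the family b, of which only the terms before
    n enter. This is the form required by the dependent choice principle, and
    \<open>good_cong\<close> is its congruence condition.\<close>
  define good where "good b n x \<longleftrightarrow> x \<in> carrier B \<and> g x = \<pi> (unit_vec R n) \<and>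
    (\<forall>u\<in>K. (\<forall>m\<ge>Suc n. u m = \<zero>) \<longrightarrow> psum B b n u \<oplus>\<^bsub>B\<^esub> u n \<odot>\<^bsub>B\<^esub> x = \<zero>\<^bsub>B\<^esub>)" for b n x
  have good_cong: "good b n = good b' n" if "\<And>i. i < n \<Longrightarrow> b i = b' i" for b b' n
  proof -
    have "psum B b n u = psum B b' n u" for u using that by (intro psum_cong) auto
    then show ?thesis by (auto simp: good_def)
  qed
  have step: "\<exists>x. good b n x" if "\<And>i. i < n \<Longrightarrow> good b i (b i)" for b n
  proof -
    \<comment> \<open>Only the predecessor of n is needed: \<open>good\<close> at k covers all
      relations supported below \<open>Suc k\<close>. For n = 0 the sum is empty.\<close>
    have b0: "psum B b n u = \<zero>\<^bsub>B\<^esub>" if "u \<in> K" "\<And>m. m \<ge> n \<Longrightarrow> u m = \<zero>" for u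
    proof (cases n)
      case (Suc k)
      then have "good b k (b k)" using \<open>\<And>i. i < n \<Longrightarrow> good b i (b i)\<close> by simp
      then show ?thesis using that Suc by (auto simp: good_def)
    qed simp
    have "b i \<in> carrier B" "g (b i) = \<pi> (unit_vec R i)" if "i < n" for i
      using \<open>\<And>i. i < n \<Longrightarrow> good b i (b i)\<close> that by (auto simp: good_def)
    then show ?thesis
      using correct_lift[OF F C B ac f g inj surj ker \<pi> G K_def _ _ _ b0] KG
      unfolding good_def K_def by blast
  qed
  obtain b where "\<And>n. good b n (b n)"
    using dependent_wellorder_choice[where P = good] good_cong step by metis
  then have bB: "b n \<in> carrier B" and gb: "g (b n) = \<pi> (unit_vec R n)"
    and bK: "u \<in> K \<Longrightarrow> (\<And>m. m \<ge> Suc n \<Longrightarrow> u m = \<zero>) \<Longrightarrow> psum B b (Suc n) u = \<zero>\<^bsub>B\<^esub>" for n u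
    unfolding good_def by auto
  \<comment> \<open>Any bound of the support gives the same value, because the additional summands
    are zero.\<close>
  define \<sigma> where "\<sigma> u = psum B b (SOME N. \<forall>m\<ge>N. u m = \<zero>) u" for u
  have \<sigma>: "\<sigma> u = psum B b N u" if "u \<in> carrier ?F" "\<And>m. m \<ge> N \<Longrightarrow> u m = \<zero>" for u N
  proof -
    define N' where "N' = (SOME N. \<forall>m\<ge>N. u m = \<zero>)"
    have N': "\<forall>m\<ge>N'. u m = \<zero>" unfolding N'_def by (rule someI[where x = N]) (simp add: that(2))
    have "psum B b (max N N') u = psum B b N u" "psum B b (max N N') u = psum B b N' u"
      using that N' bB by (auto intro!: psum_stable[OF B])
    then show ?thesis by (simp add: \<sigma>_def N'_def)
  qed
  have \<sigma>_closed: "\<sigma> u \<in> carrier B" if "u \<in> carrier ?F" for u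
    unfolding \<sigma>_def using psum_closed[OF B bB that] .
  have \<sigma>_add: "\<sigma> (u \<oplus>\<^bsub>?F\<^esub> v) = \<sigma> u \<oplus>\<^bsub>B\<^esub> \<sigma> v" if u: "u \<in> carrier ?F" and v: "v \<in> carrier ?F" for u v
  proof -
    obtain N where N: "\<And>m. m \<ge> N \<Longrightarrow> u m = \<zero>" using free_support_bound[OF u] by auto
    obtain N' where N': "\<And>m. m \<ge> N' \<Longrightarrow> v m = \<zero>" using free_support_bound[OF v] by auto
    have "\<sigma> u = psum B b (max N N') u" "\<sigma> v = psum B b (max N N') v"
      "\<sigma> (u \<oplus>\<^bsub>?F\<^esub> v) = psum B b (max N N') (u \<oplus>\<^bsub>?F\<^esub> v)"
      using N N' u v free.M.a_closed[OF u v] by (auto intro!: \<sigma>)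
    then show ?thesis using psum_add[OF B bB u v] by simp
  qed
  have \<sigma>_smult: "\<sigma> (r \<odot>\<^bsub>?F\<^esub> u) = r \<odot>\<^bsub>B\<^esub> \<sigma> u" if r: "r \<in> carrier R" and u: "u \<in> carrier ?F" for r u
  proof -
    obtain N where N: "\<And>m. m \<ge> N \<Longrightarrow> u m = \<zero>" using free_support_bound[OF u] by auto
    have "\<sigma> u = psum B b N u" "\<sigma> (r \<odot>\<^bsub>?F\<^esub> u) = psum B b N (r \<odot>\<^bsub>?F\<^esub> u)"
      using N u r free.smult_closed[OF r u] by (auto intro!: \<sigma>)
    then show ?thesis using psum_smult[OF B bB r u] by simp
  qed
  have \<sigma>_hom: "mod_hom R ?F B \<sigma>" by (intro mod_homI \<sigma>_closed \<sigma>_add \<sigma>_smult)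
  have \<sigma>K: "\<sigma> u = \<zero>\<^bsub>B\<^esub>" if u: "u \<in> K" for u
  proof -
    have uF: "u \<in> carrier ?F" using u by (simp add: K_def)
    obtain N where N: "\<And>m. m \<ge> N \<Longrightarrow> u m = \<zero>" using free_support_bound[OF uF] by auto
    \<comment> \<open>The bound N is raised to \<open>Suc N\<close> because \<open>bK\<close> speaks
      of sums up to a successor.\<close>
    then show ?thesis using \<sigma>[OF uF, of "Suc N"] bK[OF u, of N] by simp
  qed
  have g\<sigma>: "g (\<sigma> u) = \<pi> u" if u: "u \<in> carrier ?F" for u
  proof -
    obtain N where N: "\<And>m. m \<ge> N \<Longrightarrow> u m = \<zero>" using free_support_bound[OF u] by auto
    have "g (psum B b n u) = psum F (\<lambda>i. \<pi> (unit_vec R i)) n u" for n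
    proof (induction n)
      case 0
      then show ?case using mod_hom_zero[OF B F g] by simp
    next
      case (Suc n)
      then show ?case using psum_closed[OF B bB u] bB[of n] u gb[of n] by (simp add: gD)
    qed
    then show ?thesis using \<sigma>[OF u N] hom_eq_psum[OF F \<pi> N u] by simp
  qed
  have \<sigma>_eq: "\<sigma> u = \<sigma> v" if u: "u \<in> carrier ?F" and v: "v \<in> carrier ?F" and uv: "\<pi> u = \<pi> v" for u v
  proof -
    have mv: "\<ominus>\<^bsub>?F\<^esub> v \<in> carrier ?F" using v by (rule free.M.a_inv_closed)
    have "\<pi> (u \<oplus>\<^bsub>?F\<^esub> \<ominus>\<^bsub>?F\<^esub> v) = \<pi> v \<oplus>\<^bsub>F\<^esub> \<ominus>\<^bsub>F\<^esub> \<pi> v"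
      using \<pi>D(2)[OF u mv] mod_hom_minus[OF free.module_axioms F \<pi> v] uv by simp
    also have "\<dots> = \<zero>\<^bsub>F\<^esub>" using \<pi>D(1)[OF v] by (rule F.M.r_neg)
    finally have "u \<oplus>\<^bsub>?F\<^esub> \<ominus>\<^bsub>?F\<^esub> v \<in> K" using free.M.a_closed[OF u mv] unfolding K_def by blast
    then have "\<sigma> u \<oplus>\<^bsub>B\<^esub> \<ominus>\<^bsub>B\<^esub> \<sigma> v = \<zero>\<^bsub>B\<^esub>"
      using \<sigma>K \<sigma>_add[OF u mv] mod_hom_minus[OF free.module_axioms B \<sigma>_hom v] by simp
    then show ?thesis
      using \<sigma>_closed[OF u] \<sigma>_closed[OF v] B.M.minus_equality B.M.minus_minus
      by (metis B.M.a_inv_closed)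
  qed
  \<comment> \<open>By the preceding step \<sigma> is constant on the fibres of \<pi>, so the chosen
    preimage does not matter.\<close>
  define s where "s y = \<sigma> (inv_into (carrier ?F) \<pi> y)" for y
  have s: "s (\<pi> u) = \<sigma> u" if u: "u \<in> carrier ?F" for u
  proof -
    have "inv_into (carrier ?F) \<pi> (\<pi> u) \<in> carrier ?F" "\<pi> (inv_into (carrier ?F) \<pi> (\<pi> u)) = \<pi> u"
      by (rule inv_into_into[OF imageI[OF u]], rule f_inv_into_f[OF imageI[OF u]])
    then show ?thesis unfolding s_def using \<sigma>_eq u by blast
  qed
  have lift: "\<exists>u\<in>carrier ?F. y = \<pi> u" if "y \<in> carrier F" for y using that \<pi>s by blast
  have "mod_hom R F B s"
  proof (rule mod_homI)
    fix y assume "y \<in> carrier F"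
    then obtain u where u: "u \<in> carrier ?F" "y = \<pi> u" using lift by blast
    then show "s y \<in> carrier B" using s \<sigma>_closed by metis
    fix r assume r: "r \<in> carrier R"
    then show "s (r \<odot>\<^bsub>F\<^esub> y) = r \<odot>\<^bsub>B\<^esub> s y"
      using s[OF free.smult_closed[OF r u(1)]] s[OF u(1)] u(2) \<pi>D(3)[OF r u(1)]
        \<sigma>_smult[OF r u(1)] by simp
  next
    fix y z assume "y \<in> carrier F" "z \<in> carrier F"
    then obtain u v where u: "u \<in> carrier ?F" "y = \<pi> u" and v: "v \<in> carrier ?F" "z = \<pi> v"
      using lift by meson
    then show "s (y \<oplus>\<^bsub>F\<^esub> z) = s y \<oplus>\<^bsub>B\<^esub> s z"
      using s[OF free.M.a_closed[OF u(1) v(1)]] s[OF u(1)] s[OF v(1)] \<pi>D(2)[OF u(1) v(1)]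
        \<sigma>_add[OF u(1) v(1)] by simp
  qed
  moreover have "g (s y) = y" if "y \<in> carrier F" for y
    using lift[OF that] s g\<sigma> by metis
  ultimately show "\<exists>s. mod_hom R F B s \<and> (\<forall>x\<in>carrier F. g (s x) = x)" by blast
qed

theorem theorem4p14:
  fixes R :: "'a ring"
  assumes "cring R"
    and "von_neumann_regular R"
  shows "CFQ R TYPE('f) TYPE('c)"
proof -
  interpret regular_ring R
    using assms by (simp add: regular_ring_def regular_ring_axioms_def)
  show ?thesis
    unfolding CFQ_def quite_flat_def using countably_presented_ext1_vanishes by blast
qed

end
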